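(* Let $X$ be a Banach space which is quantitatively weakly sequentially complete and has the Schur property. Then the quantities $\operatorname{wk}(\cdot)$ and $\omega(\cdot)$ are equivalent in $X$ if and only if $X$ has the quantitative Schur property.
   Context: $X$ is a real or complex Banach space, canonically embedded in its bidual $X^{**}$. $X$ has the Schur property if every weakly convergent sequence in $X$ is norm-convergent. For nonempty sets, $\widehat{\operatorname{d}}(A,B)=\sup\{\operatorname{dist}(a,B): a\in A\}$. For a bounded sequence put $\operatorname{ca}(x_n)=\inf_{n}\operatorname{diam}\{x_k: k\ge n\}$ (also for scalar sequences), $\delta(x_n)=\sup\{\operatorname{ca}(x^*(x_n)): x^*\in B_{X^*}\}$, and let $\operatorname{clust}_{w^*}(x_n)$ be the set of weak$^*$-cluster points of $(x_n)$ in $X^{**}$. $X$ is $c$-weakly sequentially complete if $\widehat{\operatorname{d}}(\operatorname{clust}_{w^*}(x_n),X)\le c\,\delta(x_n)$ for each bounded sequence $(x_n)$ in $X$, and has the $c$-Schur property if $\operatorname{ca}(x_n)\le c\,\delta(x_n)$ for each bounded sequence $(x_n)$ in $X$. $X$ is quantitatively weakly sequentially complete (has the quantitative Schur property) if it is $c$-weakly sequentially complete (has the $c$-Schur property, respectively) for some $c\ge0$. For nonempty bounded $A\subset X$: $\omega(A)=\inf\{\widehat{\operatorname{d}}(A,K): K\subset X\text{ weakly compact}\}$ and $\operatorname{wk}(A)=\widehat{\operatorname{d}}(\overline{A}^{w^*},X)$, where $\overline{A}^{w^*}$ is the weak$^*$-closure of $A$ in $X^{**}$. Two quantities on bounded subsets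 of $X$ are equivalent if each is bounded above by a constant multiple of the other, with constants independent of the set. *)

theory Defs
  imports "HOL-Analysis.Analysis"
begin

text \<open>
  Real and complex Banach spaces are treated uniformly: the underlying real Banach space is a type
  of class \<^class>\<open>banach\<close>, and the scalar multiplication by the field \<open>'k\<close> (the reals or the complex
  numbers) is a parameter \<open>s\<close>. All quantities below are real-valued; every supremum and infimum is
  taken over a nonempty set that is bounded on the relevant side, as long as the sequences or sets
  they are applied to are bounded (and, for sets, nonempty).
\<close>

definition normed_scalar_mult :: "('k::real_normed_field \<Rightarrow> 'a::real_normed_vector \<Rightarrow> 'a) \<Rightarrow> bool" where
  "normed_scalar_mult s \<longleftrightarrow> vector_space s \<and> (\<forall>r x. s (of_real r) x = r *\<^sub>R x) \<and>
     (\<forall>c x. norm (s c x) = norm c * norm x)"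

lemma normed_scalar_mult_real_iff:
  fixes s :: "real \<Rightarrow> 'a::real_normed_vector \<Rightarrow> 'a"
  shows "normed_scalar_mult s \<longleftrightarrow> s = scaleR"
proof
  assume "normed_scalar_mult s"
  then show "s = scaleR"
    by (auto simp: normed_scalar_mult_def fun_eq_iff)
next
  assume "s = scaleR"
  then show "normed_scalar_mult s"
    by (simp add: normed_scalar_mult_def real_vector.vector_space_axioms)
qed

lemma normed_scalar_mult_complex_times: "normed_scalar_mult ((*) :: complex \<Rightarrow> complex \<Rightarrow> complex)"
  by (auto simp: normed_scalar_mult_def vector_space_def algebra_simps norm_mult scaleR_conv_of_real)


subsection \<open>Dual, bidual, weak and weak* topology\<close>

definition dual :: "('k::real_normed_field \<Rightarrow> 'a::real_normed_vector \<Rightarrow> 'a) \<Rightarrow> ('a \<Rightarrow> 'k) set" where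
  "dual s = {f. bounded_linear f \<and> (\<forall>c x. f (s c x) = c * f x)}"

definition dual_ball :: "('k::real_normed_field \<Rightarrow> 'a::real_normed_vector \<Rightarrow> 'a) \<Rightarrow> ('a \<Rightarrow> 'k) set" where
  "dual_ball s = {f \<in> dual s. onorm f \<le> 1}"

text \<open>Elements of the bidual are functions on \<open>dual s\<close>, extended by \<^const>\<open>undefined\<close> elsewhere, so
  that the bidual is a subset of the carrier of the product topology indexed by \<open>dual s\<close>.\<close>

definition bidual :: "('k::real_normed_field \<Rightarrow> 'a::real_normed_vector \<Rightarrow> 'a) \<Rightarrow> (('a \<Rightarrow> 'k) \<Rightarrow> 'k) set" where
  "bidual s = {F \<in> dual s \<rightarrow>\<^sub>E UNIV.
     (\<forall>f\<in>dual s. \<forall>g\<in>dual s. F (\<lambda>x. f x + g x) = F f + F g) \<and>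
     (\<forall>c. \<forall>f\<in>dual s. F (\<lambda>x. c * f x) = c * F f) \<and>
     (\<exists>K. \<forall>f\<in>dual s. norm (F f) \<le> K * onorm f)}"

definition bidual_dist ::
  "('k::real_normed_field \<Rightarrow> 'a::real_normed_vector \<Rightarrow> 'a) \<Rightarrow> (('a \<Rightarrow> 'k) \<Rightarrow> 'k) \<Rightarrow> (('a \<Rightarrow> 'k) \<Rightarrow> 'k) \<Rightarrow> real" where
  "bidual_dist s F G = (SUP f\<in>dual_ball s. norm (F f - G f))"

definition canonical_embedding ::
  "('k::real_normed_field \<Rightarrow> 'a::real_normed_vector \<Rightarrow> 'a) \<Rightarrow> 'a \<Rightarrow> ('a \<Rightarrow> 'k) \<Rightarrow> 'k" where
  "canonical_embedding s x = (\<lambda>f\<in>dual s. f x)"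

definition weak_star_topology ::
  "('k::real_normed_field \<Rightarrow> 'a::real_normed_vector \<Rightarrow> 'a) \<Rightarrow> (('a \<Rightarrow> 'k) \<Rightarrow> 'k) topology" where
  "weak_star_topology s = subtopology (product_topology (\<lambda>_. euclidean) (dual s)) (bidual s)"

definition weak_topology :: "('k::real_normed_field \<Rightarrow> 'a::real_normed_vector \<Rightarrow> 'a) \<Rightarrow> 'a topology" where
  "weak_topology s =
     pullback_topology UNIV (canonical_embedding s) (product_topology (\<lambda>_. euclidean) (dual s))"

definition weak_star_clust ::
  "('k::real_normed_field \<Rightarrow> 'a::real_normed_vector \<Rightarrow> 'a) \<Rightarrow> (nat \<Rightarrow> 'a) \<Rightarrow> (('a \<Rightarrow> 'k) \<Rightarrow> 'k) set" where
  "weak_star_clust s x = {F \<in> bidual s. \<forall>U. openin (weak_star_topology s) U \<and> F \<in> U \<longrightarrow>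
     (\<exists>\<^sub>F n in sequentially. canonical_embedding s (x n) \<in> U)}"


subsection \<open>Quantities\<close>

text \<open>The distance function is a parameter because the bidual is a set rather than a type.\<close>

definition dhat :: "('b \<Rightarrow> 'b \<Rightarrow> real) \<Rightarrow> 'b set \<Rightarrow> 'b set \<Rightarrow> real" where
  "dhat d A B = (SUP a\<in>A. INF b\<in>B. d a b)"

definition ca :: "(nat \<Rightarrow> 'b::metric_space) \<Rightarrow> real" where
  "ca x = (INF n. diameter {x k |k. k \<ge> n})"

definition delta :: "('k::real_normed_field \<Rightarrow> 'a::real_normed_vector \<Rightarrow> 'a) \<Rightarrow> (nat \<Rightarrow> 'a) \<Rightarrow> real" where
  "delta s x = (SUP f\<in>dual_ball s. ca (\<lambda>n. f (x n)))"

text \<open>The set \<open>K\<close> must be nonempty, since the infimum over the empty set of reals carries no meaning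
  (mathematically, the distance to the empty set is infinite).\<close>

definition omega :: "('k::real_normed_field \<Rightarrow> 'a::real_normed_vector \<Rightarrow> 'a) \<Rightarrow> 'a set \<Rightarrow> real" where
  "omega s A = (INF K\<in>{K. K \<noteq> {} \<and> compactin (weak_topology s) K}. dhat dist A K)"

definition wk :: "('k::real_normed_field \<Rightarrow> 'a::real_normed_vector \<Rightarrow> 'a) \<Rightarrow> 'a set \<Rightarrow> real" where
  "wk s A = dhat (bidual_dist s)
     (weak_star_topology s closure_of (canonical_embedding s ` A)) (range (canonical_embedding s))"

definition equivalent_quantities ::
  "('a::real_normed_vector set \<Rightarrow> real) \<Rightarrow> ('a set \<Rightarrow> real) \<Rightarrow> bool" where
  "equivalent_quantities p q \<longleftrightarrow>
     (\<exists>C\<ge>0. \<forall>A. A \<noteq> {} \<and> bounded A \<longrightarrow> p A \<le> C * q A) \<and>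
     (\<exists>C\<ge>0. \<forall>A. A \<noteq> {} \<and> bounded A \<longrightarrow> q A \<le> C * p A)"


subsection \<open>Schur property and weak sequential completeness\<close>

definition schur_property :: "('k::real_normed_field \<Rightarrow> 'a::real_normed_vector \<Rightarrow> 'a) \<Rightarrow> bool" where
  "schur_property s \<longleftrightarrow>
     (\<forall>x :: nat \<Rightarrow> 'a. (\<exists>l. limitin (weak_topology s) x l sequentially) \<longrightarrow> convergent x)"

definition c_weakly_seq_complete ::
  "real \<Rightarrow> ('k::real_normed_field \<Rightarrow> 'a::real_normed_vector \<Rightarrow> 'a) \<Rightarrow> bool" where
  "c_weakly_seq_complete c s \<longleftrightarrow> (\<forall>x :: nat \<Rightarrow> 'a. bounded (range x) \<longrightarrow>
     dhat (bidual_dist s) (weak_star_clust s x) (range (canonical_embedding s)) \<le> c * delta s x)"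

definition c_schur_property ::
  "real \<Rightarrow> ('k::real_normed_field \<Rightarrow> 'a::real_normed_vector \<Rightarrow> 'a) \<Rightarrow> bool" where
  "c_schur_property c s \<longleftrightarrow> (\<forall>x :: nat \<Rightarrow> 'a. bounded (range x) \<longrightarrow> ca x \<le> c * delta s x)"

definition quant_weakly_seq_complete ::
  "('k::real_normed_field \<Rightarrow> 'a::real_normed_vector \<Rightarrow> 'a) \<Rightarrow> bool" where
  "quant_weakly_seq_complete s \<longleftrightarrow> (\<exists>c\<ge>0. c_weakly_seq_complete c s)"

definition quant_schur_property ::
  "('k::real_normed_field \<Rightarrow> 'a::real_normed_vector \<Rightarrow> 'a) \<Rightarrow> bool" where
  "quant_schur_property s \<longleftrightarrow> (\<exists>c\<ge>0. c_schur_property c s)"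

end

theory Submission
  imports Defs "HOL-Complex_Analysis.Great_Picard"
begin

text \<open>
  Write \<open>d(F)\<close> for the distance of \<open>F\<close> in the bidual from the space \<open>X\<close>. The inequality
  \<open>wk \<le> omega\<close> holds in every space (\<open>wk_le_omega\<close>), so the theorem concerns only the converse estimate.
  The argument rests on a selection principle (\<open>subsequence_delta_le\<close>): if every weak* cluster point \<open>F\<close>
  of a bounded sequence has \<open>d(F) \<le> r\<close>, attained at some point of \<open>X\<close>, then some subsequence has
  \<open>delta \<le> 8 * r\<close>. It is a quantitative form of the passage from weak compactness to weak sequential
  compactness in the Eberlein-Smulian theorem, and it replaces any use of Rosenthal's \<open>\<ell>\<^sub>1\<close>-theorem.

  Suppose that \<open>X\<close> has the \<open>c\<close>-Schur property and that the bounded set \<open>A\<close> has no finite \<open>l\<close>-net. Then \<open>A\<close>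
  contains an \<open>l\<close>-separated sequence. Its cluster points lie in the weak* closure of \<open>A\<close>, so for each
  \<open>r > wk A\<close> a subsequence has \<open>delta \<le> 8 * r\<close>, whereas its \<open>ca\<close> is at least \<open>l\<close>; hence \<open>l \<le> 8 * c * r\<close>.
  Since finite sets are weakly compact, \<open>omega A \<le> 8 * c * wk A\<close> (\<open>omega_le_wk\<close>).

  Conversely, let \<open>omega \<le> C * wk\<close>, and let \<open>X\<close> be \<open>c\<close>-weakly sequentially complete with the Schur
  property. For a bounded sequence \<open>x\<close> with range \<open>A\<close>, the weak* closure of \<open>A\<close> consists of terms and cluster
  points, so \<open>wk A \<le> c * delta x\<close> (\<open>wk_range_le\<close>) and \<open>omega A \<le> C * c * delta x\<close>. By the selection principle
  with \<open>r = 0\<close> and the Schur property, bounded sequences in weakly compact sets have norm-convergent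
  subsequences. Hence \<open>x\<close> stays, up to any \<open>t > omega A\<close>, near finitely many points, and comparing those that
  are approached infinitely often gives \<open>ca x \<le> delta x + 4 * omega A\<close> (\<open>ca_le_of_omega\<close>).
\<close>

section \<open>The Hahn-Banach theorem\<close>

text \<open>Positive homogeneity is stated as an inequality; the converse inequality follows by rescaling with
  the inverse factor.\<close>

definition sublinear :: "('a::real_vector \<Rightarrow> real) \<Rightarrow> bool" where
  "sublinear p \<longleftrightarrow> (\<forall>x y. p (x + y) \<le> p x + p y) \<and> (\<forall>t x. 0 < t \<longrightarrow> p (t *\<^sub>R x) \<le> t * p x)"

lemma sublinear_add: "sublinear p \<Longrightarrow> p (x + y) \<le> p x + p y"
  by (simp add: sublinear_def)

lemma sublinear_scaleR:
  assumes "sublinear p" "0 < t" shows "p (t *\<^sub>R x) = t * p x"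
proof (rule antisym)
  show "p (t *\<^sub>R x) \<le> t * p x"
    using assms by (simp add: sublinear_def)
  have "p (inverse t *\<^sub>R (t *\<^sub>R x)) \<le> inverse t * p (t *\<^sub>R x)"
    using assms unfolding sublinear_def by (metis positive_imp_inverse_positive)
  then show "t * p x \<le> p (t *\<^sub>R x)"
    using assms(2) by (simp add: field_simps)
qed

lemma sublinear_0: assumes "sublinear p" shows "p 0 = 0"
  using sublinear_scaleR[OF assms, of 2 0] by simp

lemma sublinear_minus: assumes "sublinear p" shows "- p (- x) \<le> p x"
  using sublinear_add[OF assms, of x "- x"] sublinear_0[OF assms] by simp

text \<open>The functional \<open>q x = inf {p (x + t * y) - t * p y | t \<ge> 0}\<close> is sublinear. If \<open>p\<close> is minimal among
  sublinear functionals, then \<open>q = p\<close>, and the last inequality becomes \<open>p x + p y \<le> p (x + y)\<close>.\<close>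

lemma sublinear_lower:
  fixes p :: "'a::real_vector \<Rightarrow> real"
  assumes p: "sublinear p"
  obtains q where "sublinear q" "\<And>x. q x \<le> p x" "\<And>x. q x \<le> p (x + y) - p y"
proof -
  define h where "h = (\<lambda>x t. p (x + t *\<^sub>R y) - t * p y)"
  define q where "q = (\<lambda>x. INF t\<in>{0..}. h x t)"
  have py: "p (t *\<^sub>R y) = t * p y" if "0 \<le> t" for t
    using that sublinear_scaleR[OF p, of t y] sublinear_0[OF p] by (cases "t = 0") auto
  have "- p (- x) \<le> h x t" if "0 \<le> t" for x t
    using sublinear_add[OF p, of "x + t *\<^sub>R y" "- x"] py[OF that] by (simp add: h_def)
  then have bdd: "bdd_below (h x ` {0..})" for x
    by (intro bdd_belowI2) auto
  have q_le: "q x \<le> h x t" if "0 \<le> t" for x t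
    unfolding q_def using that by (intro cINF_lower[OF bdd]) auto
  have q_ge: "c \<le> q x" if "\<And>t. 0 \<le> t \<Longrightarrow> c \<le> h x t" for c x
    unfolding q_def using that by (intro cINF_greatest) auto
  have add: "q (x + z) \<le> q x + q z" for x z
  proof -
    have *: "q (x + z) - h z u \<le> h x t" if "0 \<le> t" "0 \<le> u" for t u
      using q_le[of "t + u" "x + z"] that sublinear_add[OF p, of "x + t *\<^sub>R y" "z + u *\<^sub>R y"]
      by (simp add: h_def algebra_simps)
    have "q (x + z) - q x \<le> h z u" if "0 \<le> u" for u
      using q_ge[of "q (x + z) - h z u" x] *[OF _ that] by force
    then show ?thesis
      using q_ge[of "q (x + z) - q x" z] by force
  qed
  have scale: "q (c *\<^sub>R x) \<le> c * q x" if "0 < c" for c x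
  proof -
    have "q (c *\<^sub>R x) \<le> c * h x t" if "0 \<le> t" for t
      using q_le[of "c * t" "c *\<^sub>R x"] that \<open>0 < c\<close> sublinear_scaleR[OF p \<open>0 < c\<close>, of "x + t *\<^sub>R y"]
      by (simp add: h_def algebra_simps)
    then have "q (c *\<^sub>R x) / c \<le> h x t" if "0 \<le> t" for t
      using that \<open>0 < c\<close> by (simp add: divide_le_eq mult.commute)
    then have "q (c *\<^sub>R x) / c \<le> q x"
      by (rule q_ge)
    then show ?thesis
      using that by (simp add: field_simps)
  qed
  show ?thesis
  proof
    show "sublinear q"
      using add scale by (auto simp: sublinear_def)
    show "q x \<le> p x" for x
      using q_le[of 0 x] by (simp add: h_def)
    show "q x \<le> p (x + y) - p y" for x
      using q_le[of 1 x] by (simp add: h_def)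
  qed
qed

text \<open>Zorn's lemma applies because the infimum of a chain of sublinear functionals below \<open>p\<close> is finite, being
  at least \<open>- p (- x)\<close> at \<open>x\<close>, and sublinear.\<close>

lemma minimal_sublinear:
  fixes p :: "'a::real_vector \<Rightarrow> real"
  assumes p: "sublinear p"
  obtains m where "sublinear m" "\<And>x. m x \<le> p x"
    "\<And>q. sublinear q \<Longrightarrow> (\<And>x. q x \<le> m x) \<Longrightarrow> q = m"
proof -
  define A where "A = {q. sublinear q \<and> (\<forall>x. q x \<le> p x)}"
  define P where "P = (\<lambda>a b :: 'a \<Rightarrow> real. b \<le> a)"
  have "\<exists>m\<in>A. \<forall>a\<in>A. P m a \<longrightarrow> a = m"
  proof (rule predicate_Zorn)
    show "partial_order_on A (relation_of P A)"
      by (auto simp: partial_order_on_def preorder_on_def refl_on_def trans_def antisym_def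
          relation_of_def P_def)
    fix C assume C: "C \<in> Chains (relation_of P A)"
    have CA: "C \<subseteq> A"
      using C by (auto simp: Chains_def relation_of_def)
    have cmp: "a \<le> b \<or> b \<le> a" if "a \<in> C" "b \<in> C" for a b
      using C that by (auto simp: Chains_def relation_of_def P_def)
    show "\<exists>u\<in>A. \<forall>a\<in>C. P a u"
    proof (cases "C = {}")
      case True
      then show ?thesis
        using p by (auto simp: A_def)
    next
      case False
      define u where "u = (\<lambda>x. INF a\<in>C. a x)"
      have sub: "sublinear a" "a x \<le> p x" if "a \<in> C" for a x
        using CA that by (auto simp: A_def)
      have "- p (- x) \<le> a x" if "a \<in> C" for a x
        using sublinear_minus[OF sub(1)[OF that], of x] sub(2)[OF that, of "- x"] by linarith
      then have "bdd_below ((\<lambda>a. a x) ` C)" for x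
        by (intro bdd_belowI2) auto
      then have u_le: "u x \<le> a x" if "a \<in> C" for a x
        unfolding u_def using that by (intro cINF_lower) auto
      have u_ge: "c \<le> u x" if "\<And>a. a \<in> C \<Longrightarrow> c \<le> a x" for c x
        unfolding u_def using that False by (intro cINF_greatest) auto
      have add: "u (x + z) \<le> u x + u z" for x z
      proof -
        have *: "u (x + z) - b z \<le> a x" if ab: "a \<in> C" "b \<in> C" for a b
          using cmp[OF ab]
        proof
          assume "a \<le> b"
          then show ?thesis
            using sublinear_add[OF sub(1)[OF ab(1)], of x z] u_le[OF ab(1), of "x + z"]
              le_funD[of a b z] by linarith
        next
          assume "b \<le> a"
          then show ?thesis
            using sublinear_add[OF sub(1)[OF ab(2)], of x z] u_le[OF ab(2), of "x + z"]
              le_funD[of b a x] by linarith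
        qed
        have "u (x + z) - u x \<le> b z" if "b \<in> C" for b
          using u_ge[of "u (x + z) - b z" x] *[OF _ that] by force
        then show ?thesis
          using u_ge[of "u (x + z) - u x" z] by force
      qed
      have scale: "u (c *\<^sub>R x) \<le> c * u x" if "0 < c" for c x
      proof -
        have "u (c *\<^sub>R x) / c \<le> a x" if "a \<in> C" for a
          using u_le[OF that, of "c *\<^sub>R x"] \<open>0 < c\<close> sublinear_scaleR[OF sub(1)[OF that] \<open>0 < c\<close>, of x]
          by (simp add: field_simps)
        then have "u (c *\<^sub>R x) / c \<le> u x"
          by (rule u_ge)
        then show ?thesis
          using that by (simp add: field_simps)
      qed
      obtain a where "a \<in> C"
        using False by auto
      then have "u x \<le> p x" for x
        using u_le[of a x] sub(2)[of a x] by linarith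
      then have "u \<in> A"
        using add scale by (simp add: A_def sublinear_def)
      then show ?thesis
        using u_le by (auto simp: P_def le_fun_def)
    qed
  qed
  then obtain m where "m \<in> A" "\<And>a. a \<in> A \<Longrightarrow> P m a \<Longrightarrow> a = m"
    by blast
  moreover have "q \<in> A" if "sublinear q" "\<And>x. q x \<le> m x" for q
    using that \<open>m \<in> A\<close> order_trans by (fastforce simp: A_def)
  ultimately show ?thesis
    by (intro that[of m]) (auto simp: A_def P_def le_fun_def)
qed

text \<open>A minimal sublinear functional is linear by \<open>sublinear_lower\<close>. Lowering \<open>p\<close> in the direction \<open>x0\<close> before
  minimizing forces the value \<open>p x0\<close> at \<open>x0\<close>.\<close>

theorem Hahn_Banach_sublinear:
  fixes p :: "'a::real_vector \<Rightarrow> real"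
  assumes p: "sublinear p"
  obtains g where "linear g" "\<And>x. g x \<le> p x" "g x0 = p x0"
proof -
  obtain q where q: "sublinear q" "\<And>x. q x \<le> p x" "\<And>x. q x \<le> p (x + x0) - p x0"
    using sublinear_lower[OF p] by blast
  obtain g where g: "sublinear g" "\<And>x. g x \<le> q x"
    and min: "\<And>r. sublinear r \<Longrightarrow> (\<And>x. r x \<le> g x) \<Longrightarrow> r = g"
    using minimal_sublinear[OF q(1)] by blast
  have add: "g (x + y) = g x + g y" for x y
  proof -
    obtain r where r: "sublinear r" "\<And>x. r x \<le> g x" "\<And>x. r x \<le> g (x + y) - g y"
      using sublinear_lower[OF g(1)] by blast
    have "g x \<le> g (x + y) - g y"
      using min[OF r(1,2)] r(3) by metis
    then show ?thesis
      using sublinear_add[OF g(1), of x y] by linarith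
  qed
  have neg: "g (- x) = - g x" for x
    using add[of x "- x"] sublinear_0[OF g(1)] by simp
  have "g (c *\<^sub>R x) = c * g x" for c x
  proof (cases c "0::real" rule: linorder_cases)
    case less
    then show ?thesis
      using sublinear_scaleR[OF g(1), of "- c" x] neg[of "c *\<^sub>R x"] by simp
  qed (use sublinear_scaleR[OF g(1)] sublinear_0[OF g(1)] in auto)
  then have "linear g"
    using add by (intro linearI) auto
  moreover have "g x \<le> p x" for x
    using g(2) q(2) order_trans by blast
  moreover have "g x0 = p x0"
    using g(2)[of "- x0"] q(3)[of "- x0"] neg[of x0] sublinear_0[OF p] \<open>g x0 \<le> p x0\<close> by simp
  ultimately show ?thesis
    by (rule that)
qed

lemma infdist_less_imp:
  assumes "Y \<noteq> {}" "infdist x Y < r" shows "\<exists>y\<in>Y. dist x y < r"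
  using assms cINF_less_iff[OF assms(1) bdd_below_image_dist, of x r] by (simp add: infdist_notempty)

lemma infdist_add_le:
  fixes Y :: "'a::real_normed_vector set"
  assumes "subspace Y" shows "infdist (x + z) Y \<le> infdist x Y + infdist z Y"
proof -
  have ne: "Y \<noteq> {}"
    using assms subspace_0 by blast
  show ?thesis
  proof (rule field_le_epsilon)
    fix e :: real assume "0 < e"
    have "\<exists>y\<in>Y. dist v y < infdist v Y + e / 2" for v
      using \<open>0 < e\<close> by (intro infdist_less_imp[OF ne]) simp
    then obtain y w where yw: "y \<in> Y" "dist x y < infdist x Y + e / 2"
      "w \<in> Y" "dist z w < infdist z Y + e / 2"
      by metis
    have "infdist (x + z) Y \<le> dist (x + z) (y + w)"
      using yw assms by (intro infdist_le) (simp add: subspace_add)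
    also have "\<dots> \<le> dist x y + dist z w"
      unfolding dist_norm add_diff_add by (rule norm_triangle_ineq)
    finally show "infdist (x + z) Y \<le> infdist x Y + infdist z Y + e"
      using yw by linarith
  qed
qed

lemma infdist_scaleR_le:
  fixes Y :: "'a::real_normed_vector set"
  assumes "subspace Y" "0 < t" shows "infdist (t *\<^sub>R x) Y \<le> t * infdist x Y"
proof -
  have ne: "Y \<noteq> {}"
    using assms subspace_0 by blast
  have "infdist (t *\<^sub>R x) Y / t \<le> infdist x Y"
    unfolding infdist_notempty[OF ne, of x]
  proof (rule cINF_greatest[OF ne])
    fix y assume "y \<in> Y"
    then have "infdist (t *\<^sub>R x) Y \<le> dist (t *\<^sub>R x) (t *\<^sub>R y)"
      using assms by (intro infdist_le) (simp add: subspace_scale)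
    also have "\<dots> = t * dist x y"
      using assms(2) unfolding dist_norm scaleR_diff_right[symmetric] norm_scaleR by simp
    finally show "infdist (t *\<^sub>R x) Y / t \<le> dist x y"
      using assms(2) by (simp add: field_simps)
  qed
  then show ?thesis
    using assms(2) by (simp add: field_simps)
qed

text \<open>Applied to the distance from a subspace \<open>Y\<close>, the theorem gives a functional of norm at most 1 that
  vanishes on \<open>Y\<close>. The case \<open>Y = {0}\<close> gives norming functionals.\<close>

corollary Hahn_Banach_infdist:
  fixes Y :: "'a::real_normed_vector set"
  assumes Y: "subspace Y"
  obtains g where "linear g" "\<And>x. \<bar>g x\<bar> \<le> norm x" "\<And>y. y \<in> Y \<Longrightarrow> g y = 0" "g x0 = infdist x0 Y"
proof -
  have "sublinear (\<lambda>x. infdist x Y)"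
    using infdist_add_le[OF Y] infdist_scaleR_le[OF Y] by (simp add: sublinear_def)
  then obtain g where g: "linear g" "\<And>x. g x \<le> infdist x Y" "g x0 = infdist x0 Y"
    using Hahn_Banach_sublinear[of "\<lambda>x. infdist x Y" x0] by blast
  have neg: "g (- x) = - g x" for x
    using g(1) by (rule linear_neg)
  have "infdist x Y \<le> norm x" for x
    using infdist_le[OF subspace_0[OF Y], of x] by simp
  then have "\<bar>g x\<bar> \<le> norm x" for x
    using g(2)[of x] g(2)[of "- x"] neg[of x] by (smt (verit) norm_minus_cancel)
  moreover have "g y = 0" if "y \<in> Y" for y
    using g(2)[of y] g(2)[of "- y"] neg[of y] that Y subspace_neg[OF Y that] by simp
  ultimately show ?thesis
    using g that by blast
qed

section \<open>The dual and the bidual\<close>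

lemma dual_linear: "f \<in> dual s \<Longrightarrow> linear f"
  by (simp add: dual_def bounded_linear.linear)

lemma dual_ball_imp_dual: "f \<in> dual_ball s \<Longrightarrow> f \<in> dual s"
  by (simp add: dual_ball_def)

lemma dual_norm_le: "f \<in> dual s \<Longrightarrow> norm (f x) \<le> onorm f * norm x"
  by (simp add: dual_def onorm)

lemma dual_ball_norm_le: "f \<in> dual_ball s \<Longrightarrow> norm (f x) \<le> norm x"
  using dual_norm_le[of f s x] mult_right_mono[of "onorm f" 1 "norm x"] by (auto simp: dual_ball_def)

lemma dual_onorm_nonneg: "f \<in> dual s \<Longrightarrow> 0 \<le> onorm f"
  by (simp add: dual_def onorm_pos_le)

lemma dual_add: "f \<in> dual s \<Longrightarrow> g \<in> dual s \<Longrightarrow> (\<lambda>x. f x + g x) \<in> dual s"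
  by (auto simp: dual_def bounded_linear_add distrib_left)

lemma dual_cmult: "f \<in> dual s \<Longrightarrow> (\<lambda>x. c * f x) \<in> dual s"
  by (auto simp: dual_def bounded_linear_const_mult algebra_simps)

lemma dual_ball_nonempty: "dual_ball s \<noteq> {}"
proof -
  have "(\<lambda>x. 0) \<in> dual_ball s"
    by (simp add: dual_ball_def dual_def onorm_zero)
  then show ?thesis
    by blast
qed

lemma emb_apply: "f \<in> dual s \<Longrightarrow> canonical_embedding s x f = f x"
  by (simp add: canonical_embedding_def)

lemma emb_in_bidual: "canonical_embedding s x \<in> bidual s"
proof -
  have "\<forall>f\<in>dual s. norm (canonical_embedding s x f) \<le> norm x * onorm f"
    using dual_norm_le[of _ s x] by (simp add: emb_apply mult.commute)
  then show ?thesis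
    unfolding bidual_def
    by (auto simp: emb_apply dual_add dual_cmult canonical_embedding_def)
qed

section \<open>Weak* closure and cluster points\<close>

text \<open>\<open>fin_approx s F A\<close> says, for \<open>F\<close> in the bidual, that \<open>F\<close> lies in the weak* closure of \<open>A\<close>: on every
  finite set of functionals it is approximated by evaluations at points of \<open>A\<close>. Cluster points of a
  sequence are those \<open>F\<close> that are approximated by each of its tails.\<close>

definition fin_approx ::
  "('k::real_normed_field \<Rightarrow> 'a::real_normed_vector \<Rightarrow> 'a) \<Rightarrow> (('a \<Rightarrow> 'k) \<Rightarrow> 'k) \<Rightarrow> 'a set \<Rightarrow> bool" where
  "fin_approx s F A \<longleftrightarrow>
     (\<forall>G e. finite G \<longrightarrow> G \<subseteq> dual s \<longrightarrow> 0 < e \<longrightarrow> (\<exists>a\<in>A. \<forall>f\<in>G. norm (f a - F f) < e))"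

lemma fin_approxD:
  assumes "fin_approx s F A" "finite G" "G \<subseteq> dual s" "0 < e"
  obtains a where "a \<in> A" "\<And>f. f \<in> G \<Longrightarrow> norm (f a - F f) < e"
  using assms unfolding fin_approx_def by meson

lemma fin_approx_mono: "fin_approx s F A \<Longrightarrow> A \<subseteq> B \<Longrightarrow> fin_approx s F B"
  unfolding fin_approx_def by (meson subsetD)

lemma product_nhds_finite:
  fixes F :: "'i \<Rightarrow> 'k::real_normed_vector"
  assumes "openin (product_topology (\<lambda>_. euclidean) I) T" "F \<in> T"
  obtains G e where "finite G" "G \<subseteq> I" "0 < e"
    "\<And>H. H \<in> extensional I \<Longrightarrow> (\<And>i. i \<in> G \<Longrightarrow> norm (H i - F i) < e) \<Longrightarrow> H \<in> T"
proof -
  from assms obtain V where V: "finite {i \<in> I. V i \<noteq> UNIV}" "\<And>i. i \<in> I \<Longrightarrow> open (V i)"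
    "F \<in> Pi\<^sub>E I V" "Pi\<^sub>E I V \<subseteq> T"
    unfolding openin_product_topology_alt by (fastforce simp flip: open_openin)
  define G where "G = {i \<in> I. V i \<noteq> UNIV}"
  have "\<exists>d>0. ball (F i) d \<subseteq> V i" if "i \<in> G" for i
    using V(2)[of i] V(3) that by (auto simp: G_def open_contains_ball)
  then obtain d where d: "\<And>i. i \<in> G \<Longrightarrow> 0 < d i" "\<And>i. i \<in> G \<Longrightarrow> ball (F i) (d i) \<subseteq> V i"
    by metis
  define e where "e = Min (insert 1 (d ` G))"
  have fin: "finite G"
    using V(1) by (simp add: G_def)
  have "0 < e"
    using fin d(1) by (simp add: e_def)
  have e_le: "e \<le> d i" if "i \<in> G" for i
    using fin that by (simp add: e_def)
  show ?thesis
  proof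
    show "finite G" "G \<subseteq> I" "0 < e"
      using fin \<open>0 < e\<close> by (auto simp: G_def)
    fix H assume H: "H \<in> extensional I" "\<And>i. i \<in> G \<Longrightarrow> norm (H i - F i) < e"
    have "H i \<in> V i" if "i \<in> I" for i
    proof (cases "i \<in> G")
      case True
      then have "H i \<in> ball (F i) (d i)"
        using H(2)[of i] e_le[of i] by (simp add: dist_norm norm_minus_commute)
      then show ?thesis
        using d(2) True by blast
    next
      case False
      then show ?thesis
        using that by (auto simp: G_def)
    qed
    then show "H \<in> T"
      using H(1) V(4) by (auto simp: PiE_def)
  qed
qed

lemma openin_product_box:
  fixes F :: "'i \<Rightarrow> 'k::real_normed_vector"
  assumes "finite G"
  shows "openin (product_topology (\<lambda>_. euclidean) I) (Pi\<^sub>E I (\<lambda>i. if i \<in> G then ball (F i) e else UNIV))"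
proof -
  have "finite {i \<in> I. (if i \<in> G then ball (F i) e else UNIV) \<noteq> UNIV}"
    using assms by (rule rev_finite_subset) auto
  then show ?thesis
    unfolding openin_PiE_gen by (auto simp flip: open_openin)
qed

lemma emb_extensional: "canonical_embedding s x \<in> extensional (dual s)"
  by (simp add: canonical_embedding_def)

lemma fin_approx_iff_nhds:
  assumes "F \<in> bidual s"
  shows "fin_approx s F A \<longleftrightarrow>
    (\<forall>U. openin (weak_star_topology s) U \<and> F \<in> U \<longrightarrow> (\<exists>a\<in>A. canonical_embedding s a \<in> U))"
proof (intro iffI allI impI)
  fix U assume approx: "fin_approx s F A" and U: "openin (weak_star_topology s) U \<and> F \<in> U"
  then obtain T where T: "openin (product_topology (\<lambda>_. euclidean) (dual s)) T" "U = T \<inter> bidual s"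
    by (auto simp: weak_star_topology_def openin_subtopology)
  obtain G e where G: "finite G" "G \<subseteq> dual s" "0 < e"
    "\<And>H. H \<in> extensional (dual s) \<Longrightarrow> (\<And>i. i \<in> G \<Longrightarrow> norm (H i - F i) < e) \<Longrightarrow> H \<in> T"
    using product_nhds_finite[OF T(1), of F] U T(2) by blast
  obtain a where a: "a \<in> A" "\<And>f. f \<in> G \<Longrightarrow> norm (f a - F f) < e"
    using fin_approxD[OF approx G(1-3)] by blast
  have "canonical_embedding s a \<in> T"
    using G(2) a(2) by (intro G(4)) (auto simp: emb_extensional emb_apply subset_iff)
  then show "\<exists>a\<in>A. canonical_embedding s a \<in> U"
    using a(1) T(2) emb_in_bidual by blast
next
  assume nhds: "\<forall>U. openin (weak_star_topology s) U \<and> F \<in> U \<longrightarrow> (\<exists>a\<in>A. canonical_embedding s a \<in> U)"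
  show "fin_approx s F A"
    unfolding fin_approx_def
  proof (intro allI impI)
    fix G and e :: real assume G: "finite G" "G \<subseteq> dual s" "0 < e"
    define W where "W = Pi\<^sub>E (dual s) (\<lambda>f. if f \<in> G then ball (F f) e else UNIV)"
    have "openin (product_topology (\<lambda>_. euclidean) (dual s)) W"
      unfolding W_def by (rule openin_product_box[OF G(1)])
    moreover have "F \<in> W"
      using assms G(3) by (auto simp: W_def bidual_def PiE_def)
    ultimately obtain a where "a \<in> A" "canonical_embedding s a \<in> W \<inter> bidual s"
      using nhds[rule_format, of "W \<inter> bidual s"] assms
      by (auto simp: weak_star_topology_def openin_subtopology)
    then have "norm (f a - F f) < e" if "f \<in> G" for f
      using that G(2) by (auto simp: W_def PiE_def Pi_def dist_norm norm_minus_commute emb_apply split: if_splits)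
    then show "\<exists>a\<in>A. \<forall>f\<in>G. norm (f a - F f) < e"
      using \<open>a \<in> A\<close> by blast
  qed
qed

lemma weak_star_closure_iff:
  "F \<in> weak_star_topology s closure_of (canonical_embedding s ` A) \<longleftrightarrow> F \<in> bidual s \<and> fin_approx s F A"
proof -
  have "topspace (weak_star_topology s) = bidual s"
    by (auto simp: weak_star_topology_def bidual_def)
  then show ?thesis
    by (auto simp: in_closure_of fin_approx_iff_nhds)
qed

lemma weak_star_clust_iff:
  "F \<in> weak_star_clust s x \<longleftrightarrow> F \<in> bidual s \<and> (\<forall>N. fin_approx s F (x ` {N..}))"
proof -
  have "(\<forall>U. openin (weak_star_topology s) U \<and> F \<in> U \<longrightarrow>
          (\<exists>\<^sub>F n in sequentially. canonical_embedding s (x n) \<in> U)) \<longleftrightarrow>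
        (\<forall>N. fin_approx s F (x ` {N..}))" if "F \<in> bidual s"
    unfolding fin_approx_iff_nhds[OF that] frequently_sequentially by fastforce
  then show ?thesis
    by (auto simp: weak_star_clust_def)
qed

lemma weak_star_clust_subset_closure:
  assumes "F \<in> weak_star_clust s x" "range x \<subseteq> A"
  shows "F \<in> weak_star_topology s closure_of (canonical_embedding s ` A)"
proof -
  have "fin_approx s F (x ` {0..})"
    using assms(1) by (simp only: weak_star_clust_iff)
  then show ?thesis
    using assms fin_approx_mono[of s F _ A] by (auto simp: weak_star_closure_iff weak_star_clust_iff)
qed

lemma weak_star_clust_reindex:
  assumes "F \<in> weak_star_clust s (x \<circ> k)" "\<And>j. j \<le> k j"
  shows "F \<in> weak_star_clust s x"
proof -
  have "(x \<circ> k) ` {N..} \<subseteq> x ` {N..}" for N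
    using assms(2) order_trans by fastforce
  then show ?thesis
    using assms(1) unfolding weak_star_clust_iff by (meson fin_approx_mono)
qed

text \<open>If the values of a functional converge along the sequence, every cluster point takes the
  limit as its value there.\<close>

lemma weak_star_clust_limit:
  assumes F: "F \<in> weak_star_clust s x" and f: "f \<in> dual s" and lim: "(\<lambda>n. f (x n)) \<longlonglongrightarrow> l"
  shows "F f = l"
proof (rule ccontr)
  assume "F f \<noteq> l"
  define e where "e = norm (F f - l) / 2"
  have "0 < e"
    using \<open>F f \<noteq> l\<close> by (simp add: e_def)
  then obtain N where N: "\<And>n. N \<le> n \<Longrightarrow> norm (f (x n) - l) < e"
    using lim by (auto simp: LIMSEQ_iff)
  have "fin_approx s F (x ` {N..})"
    using F by (simp add: weak_star_clust_iff)
  then obtain a where "a \<in> x ` {N..}" "norm (f a - F f) < e"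
    using fin_approxD[of s F "x ` {N..}" "{f}" e] f \<open>0 < e\<close> by auto
  then have "norm (F f - l) < e + e"
    using N norm_triangle_lt[of "f a - l" "F f - f a" "e + e"] by (force simp: norm_minus_commute)
  then show False
    by (simp add: e_def)
qed

text \<open>The Banach-Alaoglu argument: a bounded sequence lives in a product of compact balls, and any
  limit of it there is linear.\<close>

lemma weak_star_clust_nonempty:
  fixes s :: "'k::{real_normed_field,heine_borel} \<Rightarrow> 'a::real_normed_vector \<Rightarrow> 'a"
  assumes "bounded (range x)"
  obtains F where "F \<in> weak_star_clust s x"
proof -
  obtain M where M: "0 \<le> M" "\<And>n. norm (x n) \<le> M"
    using assms unfolding bounded_iff by (metis norm_ge_zero order_trans rangeI)
  let ?P = "product_topology (\<lambda>_. euclidean) (dual s) :: (('a \<Rightarrow> 'k) \<Rightarrow> 'k) topology"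
  define T where "T = Pi\<^sub>E (dual s) (\<lambda>f. cball (0::'k) (M * onorm f))"
  have comp: "compactin ?P T"
    unfolding T_def compactin_PiE by (auto simp: compactin_euclidean_iff)
  have "norm (f (x n)) \<le> M * onorm f" if "f \<in> dual s" for f n
    using dual_norm_le[OF that, of "x n"] mult_left_mono[OF M(2)[of n] dual_onorm_nonneg[OF that]]
    by (simp add: mult.commute)
  then have xT: "canonical_embedding s (x n) \<in> T" for n
    by (auto simp: T_def emb_apply emb_extensional PiE_def)
  define C where "C = (\<lambda>N. ?P closure_of (canonical_embedding s ` x ` {N..}))"
  have xC: "canonical_embedding s (x n) \<in> C N" if "N \<le> n" for n N
  proof -
    have "canonical_embedding s ` x ` {N..} \<subseteq> topspace ?P"
      by (auto simp: emb_extensional PiE_def)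
    then have "canonical_embedding s ` x ` {N..} \<subseteq> C N"
      unfolding C_def by (rule closure_of_subset)
    then show ?thesis
      using that by auto
  qed
  have "T \<inter> \<Inter>(range C) \<noteq> {}"
  proof -
    have "T \<inter> \<Inter>Q \<noteq> {}" if "finite Q" "Q \<subseteq> range C" for Q
    proof -
      obtain J where J: "finite J" "Q = C ` J"
        using \<open>finite Q\<close> \<open>Q \<subseteq> range C\<close> by (meson finite_subset_image)
      have "canonical_embedding s (x (Max (insert 0 J))) \<in> T \<inter> \<Inter>Q"
        using J xC xT by auto
      then show ?thesis
        by blast
    qed
    then show ?thesis
      using comp unfolding compactin_fip by (auto simp: C_def)
  qed
  then obtain F where FT: "F \<in> T" and FC: "\<And>N. F \<in> C N"
    by blast
  have Fext: "F \<in> extensional (dual s)" and Fle: "\<And>f. f \<in> dual s \<Longrightarrow> norm (F f) \<le> M * onorm f"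
    using FT by (auto simp: T_def PiE_def Pi_def)
  have approx: "fin_approx s F (x ` {N..})" for N
    unfolding fin_approx_def
  proof (intro allI impI)
    fix G and e :: real assume G: "finite G" "G \<subseteq> dual s" "0 < e"
    define W where "W = Pi\<^sub>E (dual s) (\<lambda>f. if f \<in> G then ball (F f) e else UNIV)"
    have "openin ?P W"
      unfolding W_def by (rule openin_product_box[OF G(1)])
    moreover have "F \<in> W"
      using Fext G(3) by (auto simp: W_def PiE_def)
    ultimately obtain n where "N \<le> n" "canonical_embedding s (x n) \<in> W"
      using FC[of N] unfolding C_def in_closure_of by blast
    then have "norm (f (x n) - F f) < e" if "f \<in> G" for f
      using that G(2) by (auto simp: W_def PiE_def Pi_def dist_norm norm_minus_commute emb_apply split: if_splits)
    then show "\<exists>a\<in>x ` {N..}. \<forall>f\<in>G. norm (f a - F f) < e"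
      using \<open>N \<le> n\<close> by blast
  qed
  have eq0: "z = 0" if "\<And>e. 0 < e \<Longrightarrow> norm z \<le> e * c" "0 < c" for z :: 'k and c :: real
  proof (rule ccontr)
    assume "z \<noteq> 0"
    then show False
      using that(1)[of "norm z / (2 * c)"] \<open>0 < c\<close> by simp
  qed
  have "F (\<lambda>x. f x + g x) = F f + F g" if fg: "f \<in> dual s" "g \<in> dual s" for f g
  proof -
    have "norm (F (\<lambda>x. f x + g x) - (F f + F g)) \<le> e * 3" if "0 < e" for e
    proof -
      obtain a where a: "\<And>h. h \<in> {\<lambda>x. f x + g x, f, g} \<Longrightarrow> norm (h a - F h) < e"
        by (rule fin_approxD[OF approx[of 0], of "{\<lambda>x. f x + g x, f, g}" e])
          (use fg dual_add[OF fg] \<open>0 < e\<close> in auto)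
      have "norm (f a + g a - F (\<lambda>x. f x + g x)) < e" "norm (f a - F f) < e" "norm (g a - F g) < e"
        using a[of "\<lambda>x. f x + g x"] a[of f] a[of g] by auto
      moreover have eq: "F (\<lambda>x. f x + g x) - (F f + F g) =
          (f a - F f) + (g a - F g) - (f a + g a - F (\<lambda>x. f x + g x))"
        by simp
      ultimately show ?thesis
        using norm_triangle_ineq4[of "(f a - F f) + (g a - F g)" "f a + g a - F (\<lambda>x. f x + g x)"]
          norm_triangle_ineq[of "f a - F f" "g a - F g"] unfolding eq by linarith
    qed
    then have "F (\<lambda>x. f x + g x) - (F f + F g) = 0"
      by (rule eq0) auto
    then show ?thesis
      by simp
  qed
  moreover have "F (\<lambda>x. c * f x) = c * F f" if f: "f \<in> dual s" for f c
  proof -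
    have "norm (F (\<lambda>x. c * f x) - c * F f) \<le> e * (1 + norm c)" if "0 < e" for e
    proof -
      obtain a where a: "\<And>h. h \<in> {\<lambda>x. c * f x, f} \<Longrightarrow> norm (h a - F h) < e"
        by (rule fin_approxD[OF approx[of 0], of "{\<lambda>x. c * f x, f}" e])
          (use f dual_cmult[OF f] \<open>0 < e\<close> in auto)
      have "norm (c * f a - F (\<lambda>x. c * f x)) < e" and "norm (f a - F f) < e"
        using a[of "\<lambda>x. c * f x"] a[of f] by auto
      moreover have "norm (c * (f a - F f)) \<le> norm c * e"
        using \<open>norm (f a - F f) < e\<close> by (simp add: norm_mult mult_left_mono)
      moreover have eq: "F (\<lambda>x. c * f x) - c * F f = c * (f a - F f) - (c * f a - F (\<lambda>x. c * f x))"
        by (simp add: algebra_simps)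
      moreover have "e * (1 + norm c) = e + norm c * e"
        by (simp add: algebra_simps)
      ultimately show ?thesis
        using norm_triangle_ineq4[of "c * (f a - F f)" "c * f a - F (\<lambda>x. c * f x)"]
        unfolding eq by linarith
    qed
    then have "F (\<lambda>x. c * f x) - c * F f = 0"
      by (rule eq0) (auto intro: add_pos_nonneg)
    then show ?thesis
      by simp
  qed
  ultimately have "F \<in> bidual s"
    using Fext Fle by (auto simp: bidual_def PiE_def intro!: exI[of _ M])
  then show ?thesis
    using that approx by (auto simp: weak_star_clust_iff)
qed

section \<open>Oscillation of sequences\<close>

lemma ca_le:
  fixes u :: "nat \<Rightarrow> 'b::real_normed_vector"
  assumes "bounded (range u)"
    and osc: "\<And>e. 0 < e \<Longrightarrow> \<exists>N. \<forall>m\<ge>N. \<forall>n\<ge>N. dist (u m) (u n) \<le> t + e"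
  shows "ca u \<le> t"
proof (rule field_le_epsilon)
  fix e :: real assume "0 < e"
  then obtain N where N: "\<And>m n. N \<le> m \<Longrightarrow> N \<le> n \<Longrightarrow> dist (u m) (u n) \<le> t + e"
    using osc by blast
  have "bounded {u k |k. k \<ge> n}" for n
    using assms(1) by (rule bounded_subset) auto
  then have "bdd_below (range (\<lambda>n. diameter {u k |k. k \<ge> n}))"
    by (intro bdd_belowI2[of _ 0] diameter_ge_0)
  then have "ca u \<le> diameter {u k |k. k \<ge> N}"
    unfolding ca_def by (intro cINF_lower) auto
  also have "\<dots> \<le> t + e"
    using N by (intro diameter_le) (auto simp: dist_norm)
  finally show "ca u \<le> t + e" .
qed

lemma ca_less_imp:
  fixes u :: "nat \<Rightarrow> 'b::metric_space"
  assumes "bounded (range u)" "ca u < t"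
  obtains N where "\<And>m n. N \<le> m \<Longrightarrow> N \<le> n \<Longrightarrow> dist (u m) (u n) < t"
proof -
  have bdd: "bounded {u k |k. k \<ge> n}" for n
    using assms(1) by (rule bounded_subset) auto
  obtain N where N: "diameter {u k |k. k \<ge> N} < t"
  proof (rule ccontr)
    assume "\<not> thesis"
    then have "t \<le> diameter {u k |k. k \<ge> n}" for n
      using that not_le by blast
    then have "t \<le> ca u"
      unfolding ca_def by (intro cINF_greatest) auto
    then show False
      using assms(2) by simp
  qed
  have "dist (u m) (u n) < t" if "N \<le> m" "N \<le> n" for m n
  proof -
    have "dist (u m) (u n) \<le> diameter {u k |k. k \<ge> N}"
      using that by (intro diameter_bounded_bound bdd) auto
    then show ?thesis
      using N by simp
  qed
  then show ?thesis
    using that by blast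
qed

lemma ca_nonneg:
  fixes u :: "nat \<Rightarrow> 'b::metric_space"
  assumes "bounded (range u)"
  shows "0 \<le> ca u"
proof (rule ccontr)
  assume "\<not> 0 \<le> ca u"
  then obtain N where "\<And>m n. N \<le> m \<Longrightarrow> N \<le> n \<Longrightarrow> dist (u m) (u n) < 0"
    using ca_less_imp[OF assms, of 0] by auto
  then show False
    using zero_le_dist[of "u N" "u N"] by fastforce
qed

lemma bounded_range_dual_ball:
  assumes "f \<in> dual_ball s" "bounded (range x)"
  shows "bounded (range (\<lambda>n. f (x n)))"
proof -
  obtain M where "\<And>n. norm (x n) \<le> M"
    using assms(2) by (auto simp: bounded_iff)
  then have "norm (f (x n)) \<le> M" for n
    using dual_ball_norm_le[OF assms(1), of "x n"] order_trans by blast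
  then show ?thesis
    by (auto simp: bounded_iff)
qed

lemma dual_ball_diff_le:
  assumes "f \<in> dual_ball s" shows "norm (f x - f y) \<le> norm (x - y)"
  using dual_ball_norm_le[OF assms, of "x - y"] linear_diff[OF dual_linear[OF dual_ball_imp_dual[OF assms]]]
  by simp

lemma ca_le_delta:
  assumes f: "f \<in> dual_ball s" and x: "bounded (range x)"
  shows "ca (\<lambda>n. f (x n)) \<le> delta s x"
proof -
  obtain M where M: "\<And>n. norm (x n) \<le> M"
    using x by (auto simp: bounded_iff)
  have "ca (\<lambda>n. g (x n)) \<le> 2 * M" if "g \<in> dual_ball s" for g
  proof (rule ca_le[OF bounded_range_dual_ball[OF that x]])
    fix e :: real assume "0 < e"
    have "dist (g (x m)) (g (x n)) \<le> 2 * M + e" for m n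
      using dual_ball_diff_le[OF that, of "x m" "x n"] norm_triangle_ineq4[of "x m" "x n"]
        M[of m] M[of n] \<open>0 < e\<close> by (simp add: dist_norm)
    then show "\<exists>N. \<forall>m\<ge>N. \<forall>n\<ge>N. dist (g (x m)) (g (x n)) \<le> 2 * M + e"
      by blast
  qed
  then show ?thesis
    unfolding delta_def by (intro cSUP_upper f bdd_aboveI2)
qed

lemma delta_nonneg:
  assumes "bounded (range x)" shows "0 \<le> delta s x"
proof -
  obtain f where f: "f \<in> dual_ball s"
    using dual_ball_nonempty by blast
  show ?thesis
    using ca_le_delta[OF f assms] ca_nonneg[OF bounded_range_dual_ball[OF f assms]] by linarith
qed

text \<open>The asymptotic oscillation of a functional along a bounded sequence is attained as the difference
  of its values at two weak* cluster points, so a bound on the distance between cluster points is a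
  bound on \<open>delta\<close>.\<close>

lemma delta_le_clust:
  fixes s :: "'k::{real_normed_field,heine_borel} \<Rightarrow> 'a::real_normed_vector \<Rightarrow> 'a"
  assumes y: "bounded (range y)"
    and clust: "\<And>F F' f. F \<in> weak_star_clust s y \<Longrightarrow> F' \<in> weak_star_clust s y \<Longrightarrow> f \<in> dual_ball s \<Longrightarrow>
      norm (F f - F' f) \<le> t"
  shows "delta s y \<le> t"
  unfolding delta_def
proof (rule cSUP_least[OF dual_ball_nonempty])
  fix f assume f: "f \<in> dual_ball s"
  note bf = bounded_range_dual_ball[OF f y]
  show "ca (\<lambda>n. f (y n)) \<le> t"
  proof (rule ca_le[OF bf], rule ccontr)
    fix e :: real assume e: "0 < e"
      and "\<not> (\<exists>N. \<forall>m\<ge>N. \<forall>n\<ge>N. dist (f (y m)) (f (y n)) \<le> t + e)"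
    then have "\<forall>N. \<exists>m n. N \<le> m \<and> N \<le> n \<and> t + e < dist (f (y m)) (f (y n))"
      by (meson not_le)
    then obtain p q where pq: "\<And>N. N \<le> p N" "\<And>N. N \<le> q N"
      "\<And>N. t + e < dist (f (y (p N))) (f (y (q N)))"
      by metis
    have sub: "\<exists>l r. strict_mono r \<and> ((\<lambda>n. f (y (h n))) \<circ> r) \<longlonglongrightarrow> l" for h :: "nat \<Rightarrow> nat"
    proof -
      have "bounded (range (\<lambda>n. f (y (h n))))"
        using bf by (rule bounded_subset) auto
      then show ?thesis
        by (rule bounded_imp_convergent_subsequence)
    qed
    obtain a k where k: "strict_mono k" "((\<lambda>n. f (y (p n))) \<circ> k) \<longlonglongrightarrow> a"
      using sub[of p] by blast
    obtain b j where j: "strict_mono j" "((\<lambda>n. f (y (q (k n)))) \<circ> j) \<longlonglongrightarrow> b"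
      using sub[of "\<lambda>n. q (k n)"] by blast
    have kj: "strict_mono (\<lambda>n. k (j n))"
      using k(1) j(1) by (simp add: strict_mono_def)
    have lim_a: "(\<lambda>n. f (y (p (k (j n))))) \<longlonglongrightarrow> a"
      using LIMSEQ_subseq_LIMSEQ[OF k(2) j(1)] by (simp add: o_def)
    have lim_b: "(\<lambda>n. f (y (q (k (j n))))) \<longlonglongrightarrow> b"
      using j(2) by (simp add: o_def)
    have "(\<lambda>n. dist (f (y (p (k (j n))))) (f (y (q (k (j n)))))) \<longlonglongrightarrow> dist a b"
      by (intro tendsto_dist lim_a lim_b)
    then have "t + e \<le> dist a b"
      using pq(3) by (intro LIMSEQ_le_const) (auto intro: less_imp_le)
    have cl: "\<exists>F\<in>weak_star_clust s y. F f = l"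
      if "\<And>n. n \<le> h n" and "(\<lambda>n. f (y (h n))) \<longlonglongrightarrow> l" for h l
    proof -
      have "bounded (range (y \<circ> h))"
        using y by (rule bounded_subset) auto
      then obtain F where F: "F \<in> weak_star_clust s (y \<circ> h)"
        by (rule weak_star_clust_nonempty)
      then have "F f = l"
        using that(2) by (intro weak_star_clust_limit[OF F dual_ball_imp_dual[OF f]]) simp
      then show ?thesis
        using weak_star_clust_reindex[OF F that(1)] by blast
    qed
    have ge: "n \<le> p (k (j n))" "n \<le> q (k (j n))" for n
      using strict_mono_imp_increasing[OF kj, of n] pq(1)[of "k (j n)"] pq(2)[of "k (j n)"] by linarith+
    obtain F F' where "F \<in> weak_star_clust s y" "F f = a" "F' \<in> weak_star_clust s y" "F' f = b"
      using cl[OF ge(1) lim_a] cl[OF ge(2) lim_b] by blast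
    then have "dist a b \<le> t"
      using clust[OF _ _ f] by (metis dist_norm)
    then show False
      using \<open>t + e \<le> dist a b\<close> e by linarith
  qed
qed

section \<open>Separability and finite nets\<close>

text \<open>The span of a sequence is separable: rational combinations, indexed by lists of coefficients and
  positions, are dense.\<close>

lemma countable_dense_span:
  fixes x :: "nat \<Rightarrow> 'a::real_normed_vector"
  obtains D where "countable D" "\<And>y e. y \<in> span (range x) \<Longrightarrow> 0 < e \<Longrightarrow> \<exists>d\<in>D. dist y d < e"
proof -
  define c where "c = (\<lambda>l :: (rat \<times> nat) list. \<Sum>(q, i)\<leftarrow>l. of_rat q *\<^sub>R x i)"
  have "\<forall>e>0. \<exists>l. dist y (c l) < e" if "y \<in> span (range x)" for y
    using that
  proof (induction rule: span_induct_alt)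
    case base
    have "dist 0 (c []) = 0"
      by (simp add: c_def)
    then show ?case
      by metis
  next
    case (step a b y)
    then obtain i where i: "b = x i"
      by auto
    show ?case
    proof (intro allI impI)
      fix e :: real assume "0 < e"
      obtain l where l: "dist y (c l) < e / 2"
        using step \<open>0 < e\<close> half_gt_zero by blast
      define P where "P = norm (x i) + 1"
      define h where "h = e / 2 / P"
      have "0 < P"
        by (simp add: P_def add_nonneg_pos)
      then have "0 < h"
        using \<open>0 < e\<close> by (simp add: h_def)
      then obtain q where q: "a < of_rat q" "of_rat q < a + h"
        using of_rat_dense[of a "a + h"] by auto
      have "dist (a *\<^sub>R x i) (of_rat q *\<^sub>R x i) = (of_rat q - a) * norm (x i)"
        using q by simp
      also have "\<dots> \<le> h * norm (x i)"
        using q by (intro mult_right_mono) auto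
      also have "\<dots> \<le> h * P"
        using \<open>0 < h\<close> by (simp add: P_def)
      also have "\<dots> = e / 2"
        using \<open>0 < P\<close> by (simp add: h_def)
      finally have "dist (a *\<^sub>R x i) (of_rat q *\<^sub>R x i) \<le> e / 2" .
      moreover have "c ((q, i) # l) = of_rat q *\<^sub>R x i + c l"
        by (simp add: c_def)
      moreover have "dist (a *\<^sub>R x i + y) (of_rat q *\<^sub>R x i + c l) \<le>
          dist (a *\<^sub>R x i) (of_rat q *\<^sub>R x i) + dist y (c l)"
        unfolding dist_norm add_diff_add by (rule norm_triangle_ineq)
      ultimately have "dist (a *\<^sub>R b + y) (c ((q, i) # l)) < e"
        using l i by simp
      then show "\<exists>l. dist (a *\<^sub>R b + y) (c l) < e"
        by blast
    qed
  qed
  then show ?thesis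
    by (intro that[of "range c"]) auto
qed

text \<open>A set in which no infinite sequence is \<open>e\<close>-separated has a finite \<open>e\<close>-net.\<close>

lemma finite_net:
  fixes S :: "'a::metric_space set"
  assumes no: "\<And>x :: nat \<Rightarrow> 'a. range x \<subseteq> S \<Longrightarrow> (\<And>m n. m < n \<Longrightarrow> e \<le> dist (x m) (x n)) \<Longrightarrow> False"
  shows "\<exists>T. finite T \<and> T \<subseteq> S \<and> (\<forall>y\<in>S. \<exists>z\<in>T. dist z y < e)"
proof (rule ccontr)
  assume neg: "\<not> ?thesis"
  have *: "\<exists>y\<in>S. \<forall>z\<in>T. e \<le> dist z y" if "finite T" "T \<subseteq> S" for T
  proof -
    have "\<not> (\<forall>y\<in>S. \<exists>z\<in>T. dist z y < e)"
      using neg that by blast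
    then show ?thesis
      by (auto simp: not_less)
  qed
  let ?Q = "\<lambda>x n r. r \<in> S \<and> (\<forall>m < (n::nat). e \<le> dist (x m) r)"
  have "\<exists>x. \<forall>n::nat. ?Q x n (x n)"
  proof (rule dependent_wellorder_choice)
    fix n x assume "\<And>y. y < n \<Longrightarrow> ?Q x y (x y)"
    then have "x ` {..<n} \<subseteq> S"
      by auto
    then obtain y where "y \<in> S" "\<forall>z\<in>x ` {..<n}. e \<le> dist z y"
      using *[of "x ` {..<n}"] by auto
    then show "\<exists>r. ?Q x n r"
      by auto
  qed simp
  then obtain x where x: "\<forall>n. ?Q x n (x n)" ..
  show False
    by (rule no[of x]) (use x in auto)
qed

section \<open>Distance from the bidual to the space\<close>

text \<open>\<open>dual_near s F z r\<close> says that \<open>F\<close> has norm distance at most \<open>r\<close> from the image of \<open>z\<close> in the bidual.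
  It avoids a supremum and so needs no boundedness.\<close>

definition dual_near ::
  "('k::real_normed_field \<Rightarrow> 'a::real_normed_vector \<Rightarrow> 'a) \<Rightarrow> (('a \<Rightarrow> 'k) \<Rightarrow> 'k) \<Rightarrow> 'a \<Rightarrow> real \<Rightarrow> bool" where
  "dual_near s F z r \<longleftrightarrow> (\<forall>f\<in>dual_ball s. norm (F f - f z) \<le> r)"

lemma dual_near_bidual_dist:
  assumes "F \<in> bidual s" shows "dual_near s F z (bidual_dist s F (canonical_embedding s z))"
proof -
  obtain K where K: "\<And>f. f \<in> dual s \<Longrightarrow> norm (F f) \<le> K * onorm f"
    using assms unfolding bidual_def by blast
  have "norm (F f - canonical_embedding s z f) \<le> \<bar>K\<bar> + norm z" if f: "f \<in> dual_ball s" for f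
  proof -
    have "norm (F f) \<le> K * onorm f"
      using K dual_ball_imp_dual[OF f] .
    also have "\<dots> \<le> \<bar>K\<bar> * 1"
      using f dual_onorm_nonneg[OF dual_ball_imp_dual[OF f]] by (intro mult_mono) (auto simp: dual_ball_def)
    finally show ?thesis
      using norm_triangle_ineq4[of "F f" "f z"] dual_ball_norm_le[OF f, of z]
      by (simp add: emb_apply[OF dual_ball_imp_dual[OF f]])
  qed
  then have "bdd_above ((\<lambda>f. norm (F f - canonical_embedding s z f)) ` dual_ball s)"
    by (intro bdd_aboveI2)
  then have "norm (F f - canonical_embedding s z f) \<le> bidual_dist s F (canonical_embedding s z)"
    if "f \<in> dual_ball s" for f
    unfolding bidual_dist_def using that by (intro cSUP_upper)
  then show ?thesis
    by (simp add: dual_near_def emb_apply dual_ball_imp_dual)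
qed

lemma bidual_dist_le:
  assumes "dual_near s F z r" shows "bidual_dist s F (canonical_embedding s z) \<le> r"
  unfolding bidual_dist_def using assms
  by (intro cSUP_least[OF dual_ball_nonempty]) (simp add: dual_near_def emb_apply dual_ball_imp_dual)

lemma dual_near_nonneg: "dual_near s F z r \<Longrightarrow> 0 \<le> r"
  using dual_ball_nonempty[of s] unfolding dual_near_def by (meson all_not_in_conv norm_ge_zero order_trans)

lemma bdd_below_bidual_dist:
  assumes "F \<in> bidual s"
  shows "bdd_below ((\<lambda>G. bidual_dist s F G) ` range (canonical_embedding s))"
  using dual_near_nonneg[OF dual_near_bidual_dist[OF assms]] by (intro bdd_belowI2[of _ 0]) auto

lemma INF_bidual_dist_le:
  assumes "F \<in> bidual s" "dual_near s F z r"
  shows "(INF G\<in>range (canonical_embedding s). bidual_dist s F G) \<le> r"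
  using bdd_below_bidual_dist[OF assms(1)] bidual_dist_le[OF assms(2)]
  by (intro cINF_lower2[where x = "canonical_embedding s z"]) auto

lemma dhat_embedding_le:
  assumes "S \<noteq> {}" "S \<subseteq> bidual s" "\<And>F. F \<in> S \<Longrightarrow> \<exists>z. dual_near s F z r"
  shows "dhat (bidual_dist s) S (range (canonical_embedding s)) \<le> r"
  unfolding dhat_def
proof (rule cSUP_least[OF assms(1)])
  fix F assume F: "F \<in> S"
  then obtain z where "dual_near s F z r"
    using assms(3) by blast
  then show "(INF G\<in>range (canonical_embedding s). bidual_dist s F G) \<le> r"
    using F assms(2) by (intro INF_bidual_dist_le) auto
qed

text \<open>The bound \<open>M\<close> makes the supremum in the definition of \<open>dhat\<close> an upper bound for each member.\<close>

lemma dhat_embedding_near: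
  assumes S: "S \<subseteq> bidual s" "F \<in> S"
    and M: "\<And>F f. F \<in> S \<Longrightarrow> f \<in> dual_ball s \<Longrightarrow> norm (F f) \<le> M"
    and less: "dhat (bidual_dist s) S (range (canonical_embedding s)) < r"
  obtains z where "dual_near s F z r"
proof -
  let ?D = "\<lambda>F. INF G\<in>range (canonical_embedding s). bidual_dist s F G"
  have "?D H \<le> M" if "H \<in> S" for H
  proof -
    have "norm (H f - f 0) \<le> M" if f: "f \<in> dual_ball s" for f
      using M[OF \<open>H \<in> S\<close> f] linear_0[OF dual_linear[OF dual_ball_imp_dual[OF f]]] by simp
    then have "dual_near s H 0 M"
      by (simp add: dual_near_def)
    then show ?thesis
      using that S(1) by (intro INF_bidual_dist_le) auto
  qed
  then have "?D F \<le> dhat (bidual_dist s) S (range (canonical_embedding s))"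
    unfolding dhat_def using S(2) by (intro cSUP_upper bdd_aboveI2)
  then have "?D F < r"
    using less by simp
  moreover have "bdd_below ((\<lambda>G. bidual_dist s F G) ` range (canonical_embedding s))"
    using S by (intro bdd_below_bidual_dist) auto
  ultimately obtain z where "bidual_dist s F (canonical_embedding s z) < r"
    by (subst (asm) cINF_less_iff) auto
  then have "dual_near s F z r"
    using dual_near_bidual_dist[of F s z] S by (fastforce simp: dual_near_def)
  then show ?thesis
    by (rule that)
qed

lemma fin_approx_norm_le:
  assumes "fin_approx s F A" "\<And>a. a \<in> A \<Longrightarrow> norm a \<le> M" "f \<in> dual_ball s"
  shows "norm (F f) \<le> M"
proof (rule field_le_epsilon)
  fix e :: real assume "0 < e"
  then obtain a where a: "a \<in> A" "norm (f a - F f) < e"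
    using fin_approxD[OF assms(1), of "{f}" e] dual_ball_imp_dual[OF assms(3)] by auto
  have "norm (F f) \<le> norm (f a) + norm (f a - F f)"
    using norm_triangle_ineq4[of "f a" "f a - F f"] by simp
  then show "norm (F f) \<le> M + e"
    using a assms(2)[OF a(1)] dual_ball_norm_le[OF assms(3), of a] by linarith
qed

lemma wk_near:
  assumes "bounded A" "F \<in> weak_star_topology s closure_of (canonical_embedding s ` A)" "wk s A < r"
  obtains z where "dual_near s F z r"
proof -
  obtain M where M: "\<And>a. a \<in> A \<Longrightarrow> norm a \<le> M"
    using assms(1) by (auto simp: bounded_iff)
  show ?thesis
  proof (rule dhat_embedding_near[OF _ assms(2)])
    show "weak_star_topology s closure_of (canonical_embedding s ` A) \<subseteq> bidual s"
      by (auto simp: weak_star_closure_iff)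
    show "norm (H f) \<le> M"
      if "H \<in> weak_star_topology s closure_of (canonical_embedding s ` A)" "f \<in> dual_ball s" for H f
      using that fin_approx_norm_le[OF _ M] by (auto simp: weak_star_closure_iff)
    show "dhat (bidual_dist s) (weak_star_topology s closure_of (canonical_embedding s ` A))
        (range (canonical_embedding s)) < r"
      using assms(3) by (simp add: wk_def)
  qed (rule that)
qed

lemma emb_in_closure:
  "a \<in> A \<Longrightarrow> canonical_embedding s a \<in> weak_star_topology s closure_of (canonical_embedding s ` A)"
  by (auto simp: weak_star_closure_iff emb_in_bidual fin_approx_def emb_apply subset_iff intro!: bexI[of _ a])

lemma wk_le:
  assumes "A \<noteq> {}"
    and "\<And>F. F \<in> bidual s \<Longrightarrow> fin_approx s F A \<Longrightarrow> \<exists>z. dual_near s F z r"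
  shows "wk s A \<le> r"
  unfolding wk_def
proof (rule dhat_embedding_le)
  show "weak_star_topology s closure_of (canonical_embedding s ` A) \<noteq> {}"
    using assms(1) emb_in_closure by blast
qed (use assms(2) in \<open>auto simp: weak_star_closure_iff\<close>)

lemma wk_nonneg:
  assumes "A \<noteq> {}" "bounded A" shows "0 \<le> wk s A"
proof (rule field_le_epsilon)
  fix e :: real assume "0 < e"
  obtain a where "a \<in> A"
    using assms(1) by blast
  then obtain z where "dual_near s (canonical_embedding s a) z (wk s A + e)"
    using wk_near[OF assms(2) emb_in_closure, of a s "wk s A + e"] \<open>0 < e\<close> by auto
  then show "0 \<le> wk s A + e"
    by (rule dual_near_nonneg)
qed

section \<open>Distance to weakly compact sets\<close>

lemma bdd_above_dist_INF:
  fixes A K :: "'a::metric_space set"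
  assumes "bounded A" "K \<noteq> {}"
  shows "bdd_above ((\<lambda>a. INF k\<in>K. dist a k) ` A)"
proof -
  obtain k where "k \<in> K"
    using assms(2) by blast
  obtain M where "\<And>a. a \<in> A \<Longrightarrow> dist k a \<le> M"
    using assms(1) unfolding bounded_any_center[of _ k] by blast
  then show ?thesis
    using \<open>k \<in> K\<close> by (intro bdd_aboveI2[of _ _ M] cINF_lower2) (auto simp: dist_commute)
qed

lemma omega_le:
  assumes K: "K \<noteq> {}" "compactin (weak_topology s) K"
    and A: "A \<noteq> {}" "bounded A" and near: "\<And>a. a \<in> A \<Longrightarrow> \<exists>k\<in>K. dist a k \<le> t"
  shows "omega s A \<le> t"
proof -
  have "0 \<le> dhat dist A L" if "L \<noteq> {}" for L
  proof -
    obtain a where "a \<in> A"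
      using A(1) by blast
    then have "(INF k\<in>L. dist a k) \<le> dhat dist A L"
      unfolding dhat_def by (intro cSUP_upper bdd_above_dist_INF[OF A(2) that])
    moreover have "0 \<le> (INF k\<in>L. dist a k)"
      using that by (intro cINF_greatest) auto
    ultimately show ?thesis
      by linarith
  qed
  then have "bdd_below (dhat dist A ` {K. K \<noteq> {} \<and> compactin (weak_topology s) K})"
    by (intro bdd_belowI2[of _ 0]) auto
  moreover have "dhat dist A K \<le> t"
    unfolding dhat_def
  proof (rule cSUP_least[OF A(1)])
    fix a assume "a \<in> A"
    then obtain k where "k \<in> K" "dist a k \<le> t"
      using near by blast
    then show "(INF k\<in>K. dist a k) \<le> t"
      by (intro cINF_lower2) auto
  qed
  ultimately show ?thesis
    unfolding omega_def using K by (intro cINF_lower2) auto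
qed

lemma topspace_weak_topology [simp]: "topspace (weak_topology s) = UNIV"
  by (auto simp: weak_topology_def topspace_pullback_topology emb_extensional PiE_def)

lemma omega_less:
  assumes A: "A \<noteq> {}" "bounded A" and less: "omega s A < t"
  obtains K where "K \<noteq> {}" "compactin (weak_topology s) K" "\<And>a. a \<in> A \<Longrightarrow> \<exists>k\<in>K. dist a k < t"
proof -
  obtain K where K: "K \<noteq> {}" "compactin (weak_topology s) K" "dhat dist A K < t"
  proof (rule ccontr)
    assume no: "\<not> thesis"
    have "compactin (weak_topology s) {0}"
      by simp
    then have "{K. K \<noteq> {} \<and> compactin (weak_topology s) K} \<noteq> {}"
      by blast
    moreover have "t \<le> dhat dist A K" if "K \<noteq> {}" "compactin (weak_topology s) K" for K
      using no that \<open>\<And>K. K \<noteq> {} \<Longrightarrow> _ \<Longrightarrow> _ \<Longrightarrow> thesis\<close> not_le by blast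
    ultimately have "t \<le> omega s A"
      unfolding omega_def by (intro cINF_greatest) auto
    then show False
      using less by simp
  qed
  have "\<exists>k\<in>K. dist a k < t" if "a \<in> A" for a
  proof -
    have "(INF k\<in>K. dist a k) \<le> dhat dist A K"
      unfolding dhat_def using that by (intro cSUP_upper bdd_above_dist_INF[OF A(2) K(1)])
    then have "(INF k\<in>K. dist a k) < t"
      using K(3) by simp
    then show ?thesis
      using cINF_less_iff[OF K(1) bdd_below_image_dist] by auto
  qed
  then show ?thesis
    using that K by blast
qed

lemma continuous_map_weak_dual:
  assumes "f \<in> dual s" shows "continuous_map (weak_topology s) euclidean f"
proof -
  have "continuous_map (weak_topology s) euclidean ((\<lambda>F. F f) \<circ> canonical_embedding s)"
    unfolding weak_topology_def
    by (intro continuous_map_pullback continuous_map_product_projection assms)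
  then show ?thesis
    by (simp add: o_def emb_apply[OF assms])
qed

text \<open>If \<open>A\<close> lies within \<open>t\<close> of a weakly compact set \<open>K\<close>, so does its weak* closure: the points of \<open>K\<close> that
  are close to \<open>F\<close> on finitely many functionals form a family of weakly closed sets with the finite
  intersection property. With \<open>A = K\<close> and \<open>t = 0\<close>, the set \<open>K\<close> is weak* closed in the bidual.\<close>

lemma fin_approx_weakly_compact:
  assumes K: "compactin (weak_topology s) K" and F: "fin_approx s F A"
    and near: "\<And>a. a \<in> A \<Longrightarrow> \<exists>k\<in>K. dist a k \<le> t"
  obtains k where "k \<in> K" "dual_near s F k t"
proof -
  define C where "C = (\<lambda>(f, e). {x. norm (f x - F f) \<le> t + e})"
  define I where "I = dual_ball s \<times> {0::real<..}"
  have "closedin (weak_topology s) (C i)" if "i \<in> I" for i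
  proof -
    obtain f e where i: "i = (f, e)" "f \<in> dual s"
      using \<open>i \<in> I\<close> by (auto simp: I_def dual_ball_imp_dual)
    have "C i = {x \<in> topspace (weak_topology s). f x \<in> cball (F f) (t + e)}"
      by (auto simp: C_def i dist_norm norm_minus_commute)
    then show ?thesis
      using closedin_continuous_map_preimage[OF continuous_map_weak_dual[OF i(2)], of "cball (F f) (t + e)"]
      by simp
  qed
  moreover have "K \<inter> \<Inter>Q \<noteq> {}" if Q: "finite Q" "Q \<subseteq> C ` I" for Q
  proof -
    obtain J where J: "J \<subseteq> I" "finite J" "Q = C ` J"
      using Q by (meson finite_subset_image)
    define e where "e = Min (insert 1 (snd ` J))"
    have "0 < e"
      using J by (auto simp: e_def I_def)
    have e_le: "e \<le> snd i" if "i \<in> J" for i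
      using J that by (simp add: e_def)
    have "finite (fst ` J)" "fst ` J \<subseteq> dual s"
      using J by (auto simp: I_def dual_ball_imp_dual)
    then obtain a where a: "a \<in> A" "\<And>f. f \<in> fst ` J \<Longrightarrow> norm (f a - F f) < e"
      using fin_approxD[OF F _ _ \<open>0 < e\<close>] by blast
    obtain k where k: "k \<in> K" "dist a k \<le> t"
      using near a(1) by blast
    have "k \<in> C i" if "i \<in> J" for i
    proof -
      have f: "fst i \<in> dual_ball s"
        using that J(1) by (auto simp: I_def)
      have "norm (fst i k - F (fst i)) \<le> norm (fst i k - fst i a) + norm (fst i a - F (fst i))"
        using norm_triangle_ineq[of "fst i k - fst i a" "fst i a - F (fst i)"] by simp
      also have "\<dots> \<le> t + snd i"
      proof (rule add_mono)
        show "norm (fst i k - fst i a) \<le> t"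
          using dual_ball_diff_le[OF f, of k a] k(2) by (simp add: dist_norm norm_minus_commute)
        show "norm (fst i a - F (fst i)) \<le> snd i"
          using a(2)[of "fst i"] e_le[OF that] that by simp
      qed
      finally show ?thesis
        by (simp add: C_def case_prod_unfold)
    qed
    then show ?thesis
      using J(3) k(1) by blast
  qed
  ultimately have "K \<inter> \<Inter>(C ` I) \<noteq> {}"
    using K unfolding compactin_fip by (elim conjE allE[of _ "C ` I"]) blast
  then obtain k where k: "k \<in> K" "\<And>i. i \<in> I \<Longrightarrow> k \<in> C i"
    by blast
  have "norm (F f - f k) \<le> t" if f: "f \<in> dual_ball s" for f
  proof (rule field_le_epsilon)
    fix e :: real assume "0 < e"
    then show "norm (F f - f k) \<le> t + e"
      using k(2)[of "(f, e)"] f by (simp add: I_def C_def norm_minus_commute)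
  qed
  then have "dual_near s F k t"
    by (simp add: dual_near_def)
  then show ?thesis
    using that k(1) by blast
qed

lemma wk_le_omega:
  assumes "A \<noteq> {}" "bounded A" shows "wk s A \<le> omega s A"
proof (rule field_le_epsilon)
  fix e :: real assume "0 < e"
  then have "omega s A < omega s A + e"
    by simp
  then obtain K where "K \<noteq> {}" and K: "compactin (weak_topology s) K"
    "\<And>a. a \<in> A \<Longrightarrow> \<exists>k\<in>K. dist a k < omega s A + e"
    by (rule omega_less[OF assms]) blast
  show "wk s A \<le> omega s A + e"
  proof (rule wk_le[OF assms(1)])
    fix F assume F: "fin_approx s F A"
    have "\<exists>k\<in>K. dist a k \<le> omega s A + e" if "a \<in> A" for a
      using K(2)[OF that] less_imp_le by blast
    then show "\<exists>z. dual_near s F z (omega s A + e)"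
      using fin_approx_weakly_compact[OF K(1) F] by blast
  qed
qed

section \<open>The selection principle\<close>

text \<open>The two scalar fields are treated at once: \<open>\<rho>\<close> is the identity on the reals and the real part
  on the complex numbers, and every real functional of norm at most 1 is the \<open>\<rho>\<close>-part of a
  functional in the dual ball.\<close>

locale scalar_space =
  fixes s :: "'k::{real_normed_field,heine_borel} \<Rightarrow> 'a::real_normed_vector \<Rightarrow> 'a"
    and \<rho> :: "'k \<Rightarrow> real"
  assumes \<rho>_diff: "\<rho> (a - b) = \<rho> a - \<rho> b"
    and \<rho>_le_norm: "\<bar>\<rho> a\<bar> \<le> norm a"
    and lift_functional: "linear g \<Longrightarrow> (\<And>x. \<bar>g x\<bar> \<le> norm x) \<Longrightarrow> \<exists>f\<in>dual_ball s. \<forall>x. \<rho> (f x) = g x"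
begin

lemma subspace_functional:
  assumes "subspace Y"
  obtains f where "f \<in> dual_ball s" "\<And>y. y \<in> Y \<Longrightarrow> \<rho> (f y) = 0" "\<rho> (f z) = infdist z Y"
proof -
  obtain g where g: "linear g" "\<And>x. \<bar>g x\<bar> \<le> norm x" "\<And>y. y \<in> Y \<Longrightarrow> g y = 0" "g z = infdist z Y"
    using Hahn_Banach_infdist[OF assms, of z] by blast
  obtain f where "f \<in> dual_ball s" "\<forall>x. \<rho> (f x) = g x"
    using lift_functional[OF g(1,2)] by blast
  then show ?thesis
    using g(3,4) that[of f] by auto
qed

lemma norming_functional:
  obtains f where "f \<in> dual_ball s" "\<rho> (f z) = norm z"
proof -
  obtain f where "f \<in> dual_ball s" "\<rho> (f z) = infdist z {0}"
    using subspace_functional[OF subspace_single_0, of z] by blast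
  then show ?thesis
    using that by simp
qed

text \<open>A point of \<open>X\<close> near an element of the weak* closure of \<open>Y\<close> is near \<open>Y\<close> itself.\<close>

lemma infdist_le_dual_near:
  assumes Y: "subspace Y" and F: "fin_approx s F Y" and near: "dual_near s F z r"
  shows "infdist z Y \<le> r"
proof (rule field_le_epsilon)
  fix e :: real assume "0 < e"
  obtain f where f: "f \<in> dual_ball s" "\<And>y. y \<in> Y \<Longrightarrow> \<rho> (f y) = 0" "\<rho> (f z) = infdist z Y"
    using subspace_functional[OF Y, of z] by blast
  obtain a where a: "a \<in> Y" "norm (f a - F f) < e"
    using fin_approxD[OF F, of "{f}" e] dual_ball_imp_dual[OF f(1)] \<open>0 < e\<close> by auto
  have "infdist z Y = - \<rho> (f a - f z)"
    using f a by (simp add: \<rho>_diff)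
  also have "\<dots> \<le> norm (f a - f z)"
    using \<rho>_le_norm[of "f a - f z"] by linarith
  also have "\<dots> \<le> norm (f a - F f) + norm (F f - f z)"
    using norm_triangle_ineq[of "f a - F f" "F f - f z"] by simp
  also have "\<dots> \<le> r + e"
    using a(2) near f(1) by (fastforce simp: dual_near_def)
  finally show "infdist z Y \<le> r + e" .
qed

text \<open>The selection principle. Choose a countable set \<open>C\<close> of functionals norming the differences of
  elements of a countable set \<open>D\<close> dense in the span of the sequence, and a subsequence along which
  every member of \<open>C\<close> converges. Two cluster points \<open>F\<close>, \<open>F'\<close> of the subsequence agree on \<open>C\<close>. They lie
  within \<open>r\<close> of points \<open>z\<close>, \<open>z'\<close> of the space, which lie within about \<open>r\<close> of elements \<open>d\<close>, \<open>d'\<close> of \<open>D\<close>;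
  the functional norming \<open>d - d'\<close> then gives about \<open>4 * r\<close> for the distance of \<open>d\<close> and \<open>d'\<close>, hence \<open>6 * r\<close>
  for that of \<open>z\<close> and \<open>z'\<close>, and \<open>8 * r\<close> for that of \<open>F\<close> and \<open>F'\<close>.\<close>

lemma subsequence_delta_le:
  assumes x: "bounded (range x)"
    and near: "\<And>F. F \<in> weak_star_clust s x \<Longrightarrow> \<exists>z. dual_near s F z r"
  obtains k where "strict_mono (k :: nat \<Rightarrow> nat)" "delta s (x \<circ> k) \<le> 8 * r"
proof -
  define Y where "Y = span (range x)"
  have subY: "subspace Y" and xY: "range x \<subseteq> Y"
    by (auto simp: Y_def span_base)
  obtain D where D: "countable D" "\<And>y e. y \<in> Y \<Longrightarrow> 0 < e \<Longrightarrow> \<exists>d\<in>D. dist y d < e"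
    unfolding Y_def using countable_dense_span[of x] by blast
  have "\<exists>f. f \<in> dual_ball s \<and> \<rho> (f v) = norm v" for v
    using norming_functional by blast
  then obtain \<phi> where \<phi>: "\<And>v. \<phi> v \<in> dual_ball s" "\<And>v. \<rho> (\<phi> v v) = norm v"
    by metis
  define C where "C = (\<lambda>(d, d'). \<phi> (d - d')) ` (D \<times> D)"
  have C: "countable C" "C \<subseteq> dual_ball s"
    using D(1) \<phi>(1) by (auto simp: C_def)
  obtain M where M: "\<And>n. norm (x n) \<le> M"
    using x by (auto simp: bounded_iff)
  have "norm (f (x n)) \<le> M" if "f \<in> C" for n f
    using dual_ball_norm_le[of f s "x n"] C(2) that M[of n] by auto
  then obtain k where k: "strict_mono (k :: nat \<Rightarrow> nat)" "\<And>f. f \<in> C \<Longrightarrow> \<exists>l. (\<lambda>n. f (x (k n))) \<longlonglongrightarrow> l"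
    using function_convergent_subsequence[OF C(1), of "\<lambda>n f. f (x n)" M] by blast
  have "delta s (x \<circ> k) \<le> 8 * r"
  proof (rule delta_le_clust)
    show "bounded (range (x \<circ> k))"
      using x by (rule bounded_subset) auto
    fix F F' h
    assume F: "F \<in> weak_star_clust s (x \<circ> k)" and F': "F' \<in> weak_star_clust s (x \<circ> k)"
      and h: "h \<in> dual_ball s"
    have clust: "H \<in> weak_star_clust s x" if "H \<in> weak_star_clust s (x \<circ> k)" for H
      using that strict_mono_imp_increasing[OF k(1)] by (rule weak_star_clust_reindex)
    obtain z z' where z: "dual_near s F z r" "dual_near s F' z' r"
      using near[OF clust[OF F]] near[OF clust[OF F']] by blast
    have agree: "F f = F' f" if "f \<in> C" for f
    proof -
      obtain l where l: "(\<lambda>n. f ((x \<circ> k) n)) \<longlonglongrightarrow> l"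
        using k(2) \<open>f \<in> C\<close> by auto
      have "f \<in> dual s"
        using that C(2) dual_ball_imp_dual by blast
      then show ?thesis
        using weak_star_clust_limit[OF F _ l] weak_star_clust_limit[OF F' _ l] by simp
    qed
    have inf: "infdist w Y \<le> r" if "H \<in> weak_star_clust s (x \<circ> k)" "dual_near s H w r" for H w
    proof (rule infdist_le_dual_near[OF subY _ that(2)])
      have "fin_approx s H (x ` {0..})"
        using clust[OF that(1)] by (simp only: weak_star_clust_iff)
      then show "fin_approx s H Y"
        by (rule fin_approx_mono) (use xY in auto)
    qed
    show "norm (F h - F' h) \<le> 8 * r"
    proof (rule field_le_epsilon)
      fix e0 :: real assume "0 < e0"
      define e where "e = e0 / 8"
      have "0 < e"
        using \<open>0 < e0\<close> by (simp add: e_def)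
      have near_D: "\<exists>d\<in>D. norm (w - d) \<le> r + 2 * e" if "infdist w Y \<le> r" for w
      proof -
        have "Y \<noteq> {}"
          using xY by auto
        then obtain y where y: "y \<in> Y" "dist w y < r + e"
          using infdist_less_imp[of Y w "r + e"] \<open>infdist w Y \<le> r\<close> \<open>0 < e\<close> by auto
        obtain d where "d \<in> D" "dist y d < e"
          using D(2)[OF y(1) \<open>0 < e\<close>] by blast
        then show ?thesis
          using y(2) dist_triangle[of w d y] by (intro bexI[of _ d]) (auto simp: dist_norm)
      qed
      obtain d d' where d: "d \<in> D" "norm (z - d) \<le> r + 2 * e" "d' \<in> D" "norm (z' - d') \<le> r + 2 * e"
        using near_D inf[OF F z(1)] inf[OF F' z(2)] by blast
      define f where "f = \<phi> (d - d')"
      have f: "f \<in> C" "f \<in> dual_ball s"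
        using d \<phi>(1) by (auto simp: f_def C_def)
      have "norm (d - d') = \<rho> (f (d - d'))"
        using \<phi>(2) by (simp add: f_def)
      also have "\<dots> \<le> norm (f (d - d'))"
        using \<rho>_le_norm[of "f (d - d')"] by linarith
      also have "f (d - d') = (f d - f z) + (f z - F f) + (F' f - f z') + (f z' - f d')"
        using agree[OF f(1)] linear_diff[OF dual_linear[OF dual_ball_imp_dual[OF f(2)]], of d d'] by simp
      also have "norm \<dots> \<le> norm (f d - f z) + norm (f z - F f) + norm (F' f - f z') + norm (f z' - f d')"
        by (intro order_trans[OF norm_triangle_ineq] add_mono order_refl)
      also have "\<dots> \<le> (r + 2 * e) + r + r + (r + 2 * e)"
      proof (intro add_mono)
        show "norm (f d - f z) \<le> r + 2 * e"
          using dual_ball_diff_le[OF f(2), of d z] d(2) by (simp add: norm_minus_commute)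
        show "norm (f z - F f) \<le> r"
          using z(1) f(2) by (auto simp: dual_near_def norm_minus_commute)
        show "norm (F' f - f z') \<le> r"
          using z(2) f(2) by (auto simp: dual_near_def)
        show "norm (f z' - f d') \<le> r + 2 * e"
          using dual_ball_diff_le[OF f(2), of z' d'] d(4) by simp
      qed
      finally have dd': "norm (d - d') \<le> 4 * r + 4 * e"
        by simp
      have "norm (z - z') \<le> norm (z - d) + norm (d - d') + norm (d' - z')"
        by (rule norm_diff_triangle_le[OF norm_diff_triangle_le[OF order_refl order_refl] order_refl])
      then have zz': "norm (z - z') \<le> 6 * r + 8 * e"
        using d(2,4) dd' norm_minus_commute[of d' z'] by linarith
      have "norm (F h - F' h) \<le> norm (F h - h z) + norm (h z - h z') + norm (h z' - F' h)"
        by (rule norm_diff_triangle_le[OF norm_diff_triangle_le[OF order_refl order_refl] order_refl])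
      moreover have "norm (F h - h z) \<le> r" "norm (h z' - F' h) \<le> r"
        using z h by (auto simp: dual_near_def norm_minus_commute)
      ultimately show "norm (F h - F' h) \<le> 8 * r + e0"
        using dual_ball_diff_le[OF h, of z z'] zz' by (simp add: e_def)
    qed
  qed
  then show ?thesis
    using that k(1) by blast
qed

section \<open>Weakly compact sets in Schur spaces\<close>

text \<open>Convergence on the dual ball extends to all of the dual by rescaling.\<close>

lemma limitin_weak_topology:
  assumes lim: "\<And>f. f \<in> dual_ball s \<Longrightarrow> (\<lambda>n. f (y n)) \<longlonglongrightarrow> f z"
  shows "limitin (weak_topology s) y z sequentially"
proof -
  have lim': "(\<lambda>n. f (y n)) \<longlonglongrightarrow> f z" if f: "f \<in> dual s" for f
  proof -
    define c where "c = onorm f + 1"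
    have "0 < c"
      using dual_onorm_nonneg[OF f] by (simp add: c_def)
    define g where "g = (\<lambda>x. of_real (1 / c) * f x)"
    have "onorm g \<le> 1"
      unfolding g_def
    proof (rule onorm_bound)
      fix x
      have "norm (f x) \<le> c * norm x"
        using dual_norm_le[OF f, of x] norm_ge_zero[of x]
        unfolding c_def distrib_right mult_1 by linarith
      then show "norm (of_real (1 / c) * f x) \<le> 1 * norm x"
        using \<open>0 < c\<close> by (simp add: norm_mult norm_divide field_simps)
    qed simp
    moreover have "g \<in> dual s"
      unfolding g_def by (rule dual_cmult[OF f])
    ultimately have "g \<in> dual_ball s"
      by (simp add: dual_ball_def)
    then have "(\<lambda>n. of_real c * g (y n)) \<longlonglongrightarrow> of_real c * g z"
      by (intro tendsto_mult_left lim)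
    moreover have "of_real c * g x = f x" for x
      using \<open>0 < c\<close> by (simp add: g_def)
    ultimately show ?thesis
      by simp
  qed
  show ?thesis
    unfolding limitin_def
  proof (intro conjI allI impI)
    fix U assume U: "openin (weak_topology s) U \<and> z \<in> U"
    then obtain T where T: "openin (product_topology (\<lambda>_. euclidean) (dual s)) T"
      "U = canonical_embedding s -` T \<inter> UNIV"
      by (auto simp: weak_topology_def openin_pullback_topology)
    obtain G e where G: "finite G" "G \<subseteq> dual s" "0 < e"
      "\<And>H. H \<in> extensional (dual s) \<Longrightarrow>
        (\<And>i. i \<in> G \<Longrightarrow> norm (H i - canonical_embedding s z i) < e) \<Longrightarrow> H \<in> T"
      using product_nhds_finite[OF T(1), of "canonical_embedding s z"] U T(2) by blast
    have "eventually (\<lambda>n. \<forall>f\<in>G. norm (f (y n) - f z) < e) sequentially"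
    proof (intro eventually_ball_finite G(1) ballI)
      fix f assume "f \<in> G"
      then show "eventually (\<lambda>n. norm (f (y n) - f z) < e) sequentially"
        using tendstoD[OF lim' \<open>0 < e\<close>, of f] G(2) by (auto simp: dist_norm)
    qed
    then show "eventually (\<lambda>n. y n \<in> U) sequentially"
    proof (rule eventually_mono)
      fix n assume "\<forall>f\<in>G. norm (f (y n) - f z) < e"
      then have "canonical_embedding s (y n) \<in> T"
        using G(2) by (intro G(4)) (auto simp: emb_extensional emb_apply subset_iff)
      then show "y n \<in> U"
        using T(2) by simp
    qed
  qed simp
qed

text \<open>A bounded sequence in a weakly compact set has a weakly convergent subsequence: its cluster points
  belong to the set, so the selection principle applies with \<open>r = 0\<close>. With the Schur property the
  subsequence is norm-convergent.\<close>

lemma schur_weakly_compact_not_separated: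
  fixes x :: "nat \<Rightarrow> 'a"
  assumes schur: "schur_property s" and K: "compactin (weak_topology s) K"
    and x: "range x \<subseteq> K" "bounded (range x)"
    and sep: "\<And>m n. m < n \<Longrightarrow> e \<le> dist (x m) (x n)" and "0 < e"
  shows False
proof -
  have inK: "\<exists>z\<in>K. dual_near s F z 0" if "F \<in> weak_star_clust s y" "range y \<subseteq> K" for F and y :: "nat \<Rightarrow> 'a"
  proof -
    have "fin_approx s F (y ` {0..})"
      using that(1) by (simp only: weak_star_clust_iff)
    then have F: "fin_approx s F K"
      by (rule fin_approx_mono) (use that(2) in auto)
    have "\<exists>k\<in>K. dist a k \<le> 0" if "a \<in> K" for a
      using that by (intro bexI[of _ a]) auto
    then show ?thesis
      using fin_approx_weakly_compact[OF K F] by blast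
  qed
  have "\<exists>z. dual_near s F z 0" if "F \<in> weak_star_clust s x" for F
    using inK[OF that x(1)] by blast
  then obtain k :: "nat \<Rightarrow> nat" where k: "strict_mono k" "delta s (x \<circ> k) \<le> 0"
    using subsequence_delta_le[OF x(2), of 0] by auto
  define y where "y = x \<circ> k"
  have y: "bounded (range y)" "range y \<subseteq> K"
    using x by (auto simp: y_def intro: bounded_subset)
  obtain F where F: "F \<in> weak_star_clust s y"
    using weak_star_clust_nonempty[OF y(1)] .
  obtain z where z: "dual_near s F z 0"
    using inK[OF F y(2)] by blast
  have "(\<lambda>n. f (y n)) \<longlonglongrightarrow> f z" if f: "f \<in> dual_ball s" for f
  proof -
    have Fz: "F f = f z"
      using z f by (auto simp: dual_near_def)
    have ca0: "ca (\<lambda>n. f (y n)) \<le> 0"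
      using ca_le_delta[OF f y(1)] k(2) by (simp add: y_def)
    show ?thesis
    proof (rule LIMSEQ_I)
      fix r :: real assume "0 < r"
      then obtain N where N: "\<And>m n. N \<le> m \<Longrightarrow> N \<le> n \<Longrightarrow> dist (f (y m)) (f (y n)) < r / 2"
        using ca_less_imp[OF bounded_range_dual_ball[OF f y(1)], of "r / 2"] ca0 by auto
      have "fin_approx s F (y ` {N..})"
        using F by (simp only: weak_star_clust_iff)
      then obtain a where "a \<in> y ` {N..}" "norm (f a - F f) < r / 2"
        using fin_approxD[of s F "y ` {N..}" "{f}" "r / 2"] dual_ball_imp_dual[OF f] \<open>0 < r\<close> by auto
      then obtain m where m: "N \<le> m" "dist (f (y m)) (f z) < r / 2"
        using Fz by (auto simp: dist_norm)
      have "norm (f (y n) - f z) < r" if "N \<le> n" for n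
        using N[OF that m(1)] m(2) dist_triangle[of "f (y n)" "f z" "f (y m)"] by (simp add: dist_norm)
      then show "\<exists>N. \<forall>n\<ge>N. norm (f (y n) - f z) < r"
        by blast
    qed
  qed
  then have "convergent y"
    using schur limitin_weak_topology[of y z] by (auto simp: schur_property_def)
  then have "Cauchy y"
    by (rule convergent_Cauchy)
  then obtain N where "\<And>m n. N \<le> m \<Longrightarrow> N \<le> n \<Longrightarrow> dist (y m) (y n) < e"
    using \<open>0 < e\<close> unfolding Cauchy_def by blast
  then have "dist (y N) (y (Suc N)) < e"
    by simp
  then show False
    using sep[of "k N" "k (Suc N)"] k(1) by (simp add: y_def strict_mono_Suc_iff)
qed

section \<open>The equivalence\<close>

text \<open>If \<open>A\<close> has no finite \<open>l\<close>-net, it contains an \<open>l\<close>-separated sequence, all of whose subsequences have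
  \<open>ca\<close> at least \<open>l\<close>. The selection principle provides a subsequence with small \<open>delta\<close>, and the
  \<open>c\<close>-Schur property compares the two. Finite sets being weakly compact, a finite net bounds \<open>omega\<close>.\<close>

lemma omega_le_wk:
  assumes c: "0 \<le> c" "c_schur_property c s" and A: "A \<noteq> {}" "bounded A"
  shows "omega s A \<le> 8 * c * wk s A"
proof -
  have *: "omega s A \<le> 8 * c * r" if r: "wk s A < r" for r
  proof (rule ccontr)
    assume "\<not> omega s A \<le> 8 * c * r"
    then obtain l where l: "8 * c * r < l" "l < omega s A"
      using dense not_le by metis
    have "0 \<le> r"
      using wk_nonneg[OF A, of s] r by linarith
    have "\<exists>T. finite T \<and> T \<subseteq> A \<and> (\<forall>y\<in>A. \<exists>z\<in>T. dist z y < l)"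
    proof (rule finite_net)
      fix x :: "nat \<Rightarrow> 'a"
      assume x: "range x \<subseteq> A" and sep: "\<And>m n. m < n \<Longrightarrow> l \<le> dist (x m) (x n)"
      have bx: "bounded (range x)"
        using A(2) x bounded_subset by blast
      have "\<exists>z. dual_near s F z r" if "F \<in> weak_star_clust s x" for F
        using wk_near[OF A(2) weak_star_clust_subset_closure[OF that x] r] by blast
      then obtain k :: "nat \<Rightarrow> nat" where k: "strict_mono k" "delta s (x \<circ> k) \<le> 8 * r"
        using subsequence_delta_le[OF bx, of r] by blast
      have bk: "bounded (range (x \<circ> k))"
        using bx by (rule bounded_subset) auto
      have "ca (x \<circ> k) \<le> c * delta s (x \<circ> k)"
        using c(2) bk unfolding c_schur_property_def by blast
      also have "\<dots> \<le> c * (8 * r)"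
        using k(2) c(1) by (rule mult_left_mono)
      finally have "ca (x \<circ> k) < l"
        using l(1) by simp
      then obtain N where "\<And>m n. N \<le> m \<Longrightarrow> N \<le> n \<Longrightarrow> dist ((x \<circ> k) m) ((x \<circ> k) n) < l"
        using ca_less_imp[OF bk] by blast
      then have "dist (x (k N)) (x (k (Suc N))) < l"
        by simp
      then show False
        using sep[of "k N" "k (Suc N)"] k(1) by (simp add: strict_mono_Suc_iff)
    qed
    then obtain T where T: "finite T" "T \<subseteq> A" "\<And>y. y \<in> A \<Longrightarrow> \<exists>z\<in>T. dist z y < l"
      by blast
    have "omega s A \<le> l"
    proof (rule omega_le[OF _ _ A])
      show "T \<noteq> {}"
        using T(3) A(1) by blast
      show "compactin (weak_topology s) T"
        using T(1) by (simp add: finite_imp_compactin)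
      show "\<exists>k\<in>T. dist a k \<le> l" if "a \<in> A" for a
        using T(3)[OF that] by (metis dist_commute less_imp_le)
    qed
    then show False
      using l(2) by simp
  qed
  show ?thesis
  proof (rule field_le_epsilon)
    fix e :: real assume "0 < e"
    define d where "d = e / (8 * c + 1)"
    have "0 < d"
      using \<open>0 < e\<close> c(1) by (simp add: d_def add_nonneg_pos)
    have "d * (8 * c + 1) = e"
      using c(1) by (simp add: d_def add_nonneg_eq_0_iff)
    then have "8 * c * d \<le> e"
      using \<open>0 < d\<close> by (simp add: algebra_simps)
    then show "omega s A \<le> 8 * c * wk s A + e"
      using *[of "wk s A + d"] \<open>0 < d\<close> by (simp add: algebra_simps)
  qed
qed

text \<open>A point of the weak* closure of the range of a sequence is a term of the sequence or a cluster
  point.\<close>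

lemma wk_range_le:
  assumes c: "0 \<le> c" "c_weakly_seq_complete c s" and x: "bounded (range x)"
  shows "wk s (range x) \<le> c * delta s x"
proof (rule field_le_epsilon)
  fix e :: real assume "0 < e"
  obtain M where M: "\<And>a. a \<in> range x \<Longrightarrow> norm a \<le> M"
    using x by (auto simp: bounded_iff)
  have "dhat (bidual_dist s) (weak_star_clust s x) (range (canonical_embedding s)) \<le> c * delta s x"
    using c(2) x by (simp add: c_weakly_seq_complete_def)
  then have less: "dhat (bidual_dist s) (weak_star_clust s x) (range (canonical_embedding s)) < c * delta s x + e"
    using \<open>0 < e\<close> by linarith
  show "wk s (range x) \<le> c * delta s x + e"
  proof (rule wk_le)
    fix F assume F: "F \<in> bidual s" "fin_approx s F (range x)"
    show "\<exists>z. dual_near s F z (c * delta s x + e)"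
    proof (cases "F \<in> range (\<lambda>n. canonical_embedding s (x n))")
      case True
      then obtain n where "F = canonical_embedding s (x n)"
        by blast
      then have "dual_near s F (x n) (c * delta s x + e)"
        using c(1) delta_nonneg[OF x, of s] \<open>0 < e\<close> by (simp add: dual_near_def emb_apply dual_ball_imp_dual)
      then show ?thesis
        by blast
    next
      case False
      have "\<exists>f\<in>dual s. f (x n) \<noteq> F f" for n
      proof (rule ccontr)
        assume "\<not> ?thesis"
        then have "F = canonical_embedding s (x n)"
          using F(1) by (intro extensionalityI[of _ "dual s"]) (auto simp: bidual_def PiE_def emb_extensional emb_apply)
        then show False
          using False by blast
      qed
      then obtain h where h: "\<And>n. h n \<in> dual s" "\<And>n. h n (x n) \<noteq> F (h n)"
        by metis
      \<comment> \<open>Finitely many terms can be excluded by finitely many further functionals.\<close>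
      have "fin_approx s F (x ` {N..})" for N
        unfolding fin_approx_def
      proof (intro allI impI)
        fix G and e :: real assume G: "finite G" "G \<subseteq> dual s" "0 < e"
        define d where "d = Min (insert e ((\<lambda>n. norm (h n (x n) - F (h n))) ` {..<N}))"
        have d: "0 < d" "d \<le> e" and dn: "\<And>n. n < N \<Longrightarrow> d \<le> norm (h n (x n) - F (h n))"
          using G(3) h(2) by (auto simp: d_def)
        have "finite (G \<union> h ` {..<N})" "G \<union> h ` {..<N} \<subseteq> dual s"
          using G h(1) by auto
        then obtain a where a: "a \<in> range x" "\<And>f. f \<in> G \<union> h ` {..<N} \<Longrightarrow> norm (f a - F f) < d"
          by (rule fin_approxD[OF F(2) _ _ d(1)]) blast
        obtain n where n: "a = x n"
          using a(1) by blast
        have "N \<le> n"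
        proof (rule ccontr)
          assume "\<not> N \<le> n"
          then show False
            using a(2)[of "h n"] dn[of n] n by force
        qed
        then show "\<exists>a\<in>x ` {N..}. \<forall>f\<in>G. norm (f a - F f) < e"
          using a(2) d(2) n by (intro bexI[of _ a]) force+
      qed
      then have "F \<in> weak_star_clust s x"
        using F(1) by (simp add: weak_star_clust_iff)
      then show ?thesis
      proof (rule dhat_embedding_near[rotated])
        show "weak_star_clust s x \<subseteq> bidual s"
          by (auto simp: weak_star_clust_iff)
        show "norm (H f) \<le> M" if "H \<in> weak_star_clust s x" "f \<in> dual_ball s" for H f
        proof (rule fin_approx_norm_le[OF _ M that(2)])
          have "fin_approx s H (x ` {0..})"
            using that(1) by (simp only: weak_star_clust_iff)
          then show "fin_approx s H (range x)"
            by (rule fin_approx_mono) auto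
        qed
      qed (use less in blast)+
    qed
  qed simp
qed

text \<open>In a Schur space a sequence near a weakly compact set is, up to a small error, near a sequence \<open>p\<close>
  with finitely many values. Two values that are taken infinitely often cannot be further apart than
  \<open>delta\<close> plus twice the error, as a functional norming their difference shows.\<close>

lemma ca_le_of_omega:
  assumes schur: "schur_property s" and x: "bounded (range x)"
  shows "ca x \<le> delta s x + 4 * omega s (range x)"
proof (rule ca_le[OF x])
  fix e0 :: real assume "0 < e0"
  define e where "e = e0 / 12"
  have "0 < e"
    using \<open>0 < e0\<close> by (simp add: e_def)
  define t where "t = omega s (range x) + e"
  have "omega s (range x) < t"
    using \<open>0 < e\<close> by (simp add: t_def)
  then obtain K where K: "compactin (weak_topology s) K" "\<And>a. a \<in> range x \<Longrightarrow> \<exists>k\<in>K. dist a k < t"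
    using omega_less[OF _ x, of s t] by blast
  then have "\<exists>k\<in>K. dist (x n) k < t" for n
    by blast
  then obtain w where w: "\<And>n. w n \<in> K" "\<And>n. dist (x n) (w n) < t"
    by metis
  obtain M where M: "\<And>n. norm (x n) \<le> M"
    using x by (auto simp: bounded_iff)
  have "norm (w n) \<le> M + t" for n
    using norm_triangle_ineq[of "x n" "w n - x n"] M[of n] w(2)[of n] by (simp add: dist_norm norm_minus_commute)
  then have bw: "bounded (range w)"
    by (auto simp: bounded_iff)
  have "\<exists>T. finite T \<and> T \<subseteq> range w \<and> (\<forall>v\<in>range w. \<exists>z\<in>T. dist z v < e)"
  proof (rule finite_net)
    fix y :: "nat \<Rightarrow> 'a"
    assume y: "range y \<subseteq> range w" and sep: "\<And>m n. m < n \<Longrightarrow> e \<le> dist (y m) (y n)"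
    have "range w \<subseteq> K"
      using w(1) by auto
    with y have "range y \<subseteq> K"
      by (rule order_trans)
    moreover have "bounded (range y)"
      using bw y by (rule bounded_subset)
    ultimately show False
      using sep \<open>0 < e\<close> by (rule schur_weakly_compact_not_separated[OF schur K(1)])
  qed
  then obtain T where T: "finite T" "T \<subseteq> range w" "\<And>v. v \<in> range w \<Longrightarrow> \<exists>z\<in>T. dist z v < e"
    by blast
  then have "\<exists>z\<in>T. dist z (w n) < e" for n
    by blast
  then obtain p where p: "\<And>n. p n \<in> T" "\<And>n. dist (p n) (w n) < e"
    by metis
  define u where "u = t + e"
  have xp: "norm (x n - p n) < u" for n
    using w(2)[of n] p(2)[of n] dist_triangle[of "x n" "p n" "w n"] by (simp add: u_def dist_norm norm_minus_commute)
  \<comment> \<open>From some index on, every value of \<open>p\<close> is taken infinitely often.\<close>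
  have "finite (\<Union>v\<in>{v \<in> T. finite {n. p n = v}}. {n. p n = v})"
    using T(1) by auto
  then obtain N where N: "\<And>n. n \<in> (\<Union>v\<in>{v \<in> T. finite {n. p n = v}}. {n. p n = v}) \<Longrightarrow> n < N"
    by (metis finite_nat_set_iff_bounded)
  have inf: "\<exists>m'\<ge>n. p m' = p m" if "N \<le> m" for m n
  proof -
    have "infinite {n. p n = p m}"
      using N[of m] that p(1) by fastforce
    then show ?thesis
      by (metis (mono_tags) infinite_nat_iff_unbounded_le mem_Collect_eq)
  qed
  have pp: "norm (p m - p n) \<le> delta s x + 2 * u + e" if mn: "N \<le> m" "N \<le> n" for m n
  proof -
    obtain f where f: "f \<in> dual_ball s" "\<rho> (f (p m - p n)) = norm (p m - p n)"
      by (rule norming_functional)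
    have "ca (\<lambda>n. f (x n)) < delta s x + e"
      using ca_le_delta[OF f(1) x] \<open>0 < e\<close> by simp
    then obtain N' where N': "\<And>m n. N' \<le> m \<Longrightarrow> N' \<le> n \<Longrightarrow> dist (f (x m)) (f (x n)) < delta s x + e"
      using ca_less_imp[OF bounded_range_dual_ball[OF f(1) x]] by blast
    obtain m' n' where m': "N' \<le> m'" "p m' = p m" and n': "N' \<le> n'" "p n' = p n"
      using inf mn by meson
    have "norm (p m - p n) \<le> norm (f (p m - p n))"
      using f(2) \<rho>_le_norm[of "f (p m - p n)"] by linarith
    also have "f (p m - p n) = (f (p m') - f (x m')) + (f (x m') - f (x n')) + (f (x n') - f (p n'))"
      using m' n' linear_diff[OF dual_linear[OF dual_ball_imp_dual[OF f(1)]]] by simp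
    also have "norm \<dots> \<le> norm (f (p m') - f (x m')) + norm (f (x m') - f (x n')) + norm (f (x n') - f (p n'))"
      by (intro order_trans[OF norm_triangle_ineq] add_mono order_refl)
    also have "\<dots> \<le> delta s x + 2 * u + e"
      using dual_ball_diff_le[OF f(1), of "p m'" "x m'"] dual_ball_diff_le[OF f(1), of "x n'" "p n'"]
        xp[of m'] xp[of n'] N'[OF m'(1) n'(1)] by (simp add: dist_norm norm_minus_commute)
    finally show ?thesis .
  qed
  have "dist (x m) (x n) \<le> delta s x + 4 * omega s (range x) + e0" if mn: "N \<le> m" "N \<le> n" for m n
  proof -
    have "norm (x m - x n) \<le> norm (x m - p m) + norm (p m - p n) + norm (p n - x n)"
      by (rule norm_diff_triangle_le[OF norm_diff_triangle_le[OF order_refl order_refl] order_refl])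
    also have "\<dots> \<le> delta s x + 4 * u + e"
      using xp[of m] xp[of n] pp[OF mn] norm_minus_commute[of "p n" "x n"] by linarith
    also have "\<dots> \<le> delta s x + 4 * omega s (range x) + e0"
      using \<open>0 < e\<close> by (simp add: u_def t_def e_def)
    finally show ?thesis
      by (simp add: dist_norm)
  qed
  then show "\<exists>N. \<forall>m\<ge>N. \<forall>n\<ge>N. dist (x m) (x n) \<le> delta s x + 4 * omega s (range x) + e0"
    by blast
qed

theorem equivalent_iff_quant_schur:
  assumes wsc: "quant_weakly_seq_complete s" and schur: "schur_property s"
  shows "equivalent_quantities (wk s) (omega s) \<longleftrightarrow> quant_schur_property s"
proof
  assume "equivalent_quantities (wk s) (omega s)"
  then obtain C where C: "0 \<le> C" "\<And>A. A \<noteq> {} \<Longrightarrow> bounded A \<Longrightarrow> omega s A \<le> C * wk s A"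
    unfolding equivalent_quantities_def by blast
  obtain c where c: "0 \<le> c" "c_weakly_seq_complete c s"
    using wsc by (auto simp: quant_weakly_seq_complete_def)
  have "ca x \<le> (1 + 4 * (C * c)) * delta s x" if x: "bounded (range x)" for x :: "nat \<Rightarrow> 'a"
  proof -
    have "omega s (range x) \<le> C * wk s (range x)"
      using C(2)[OF _ x] by simp
    also have "\<dots> \<le> C * (c * delta s x)"
      using wk_range_le[OF c x] C(1) by (rule mult_left_mono)
    finally show ?thesis
      using ca_le_of_omega[OF schur x] by (simp add: algebra_simps)
  qed
  then have "c_schur_property (1 + 4 * (C * c)) s"
    by (simp add: c_schur_property_def)
  then show "quant_schur_property s"
    using C(1) c(1) unfolding quant_schur_property_def by (intro exI[of _ "1 + 4 * (C * c)"]) simp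
next
  assume "quant_schur_property s"
  then obtain c where c: "0 \<le> c" "c_schur_property c s"
    by (auto simp: quant_schur_property_def)
  have "\<forall>A. A \<noteq> {} \<and> bounded A \<longrightarrow> wk s A \<le> 1 * omega s A"
    using wk_le_omega by auto
  moreover have "\<forall>A. A \<noteq> {} \<and> bounded A \<longrightarrow> omega s A \<le> (8 * c) * wk s A"
    using omega_le_wk[OF c] by auto
  moreover have "(0::real) \<le> 1" "0 \<le> 8 * c"
    using c(1) by auto
  ultimately show "equivalent_quantities (wk s) (omega s)"
    unfolding equivalent_quantities_def by blast
qed

end

lemma scalar_space_real:
  fixes s :: "real \<Rightarrow> 'a::real_normed_vector \<Rightarrow> 'a"
  assumes "normed_scalar_mult s"
  shows "scalar_space s (\<lambda>z. z)"
proof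
  have s: "s = scaleR"
    using assms by (simp add: normed_scalar_mult_real_iff)
  fix g :: "'a \<Rightarrow> real" assume g: "linear g" "\<And>x. \<bar>g x\<bar> \<le> norm x"
  have "bounded_linear g"
    using g by (intro bounded_linear_intro[of g 1]) (auto simp: linear_add linear_scale)
  moreover have "onorm g \<le> 1"
    using g(2) by (intro onorm_bound) auto
  ultimately have "g \<in> dual_ball s"
    using g(1) by (simp add: dual_ball_def dual_def s linear_scale)
  then show "\<exists>f\<in>dual_ball s. \<forall>x. f x = g x"
    by blast
qed auto

text \<open>A real functional \<open>g\<close> is the real part of the complex functional \<open>g x - \<i> g (\<i> x)\<close>.\<close>

lemma scalar_space_complex:
  fixes s :: "complex \<Rightarrow> 'a::real_normed_vector \<Rightarrow> 'a"
  assumes s: "normed_scalar_mult s"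
  shows "scalar_space s Re"
proof
  interpret vector_space s
    using s by (simp add: normed_scalar_mult_def)
  have s_real: "s (of_real r) x = r *\<^sub>R x" and s_norm: "norm (s c x) = norm c * norm x" for r c x
    using s by (auto simp: normed_scalar_mult_def)
  have s_decomp: "s c x = Re c *\<^sub>R x + Im c *\<^sub>R s \<i> x" for c x
  proof -
    have "s c x = s (of_real (Re c) + of_real (Im c) * \<i>) x"
      by (simp add: complex_eq mult.commute)
    then show ?thesis
      by (simp only: scale_left_distrib s_real flip: scale_scale)
  qed
  fix g :: "'a \<Rightarrow> real" assume g: "linear g" "\<And>x. \<bar>g x\<bar> \<le> norm x"
  define f where "f = (\<lambda>x. Complex (g x) (- g (s \<i> x)))"
  have sii: "s \<i> (s \<i> x) = - x" for x
    using s_real[of "-1" x] by simp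
  have f_scale: "f (s c x) = c * f x" for c x
  proof -
    have "s \<i> (s c x) = Re c *\<^sub>R s \<i> x - Im c *\<^sub>R x"
      using s_decomp[of "\<i> * c" x] by simp
    then show ?thesis
      using s_decomp[of c x] g(1)
      by (simp add: f_def complex_eq_iff linear_add linear_diff linear_scale)
  qed
  have f_norm: "norm (f x) \<le> norm x" for x
  proof (cases "f x = 0")
    case False
    \<comment> \<open>Rotate \<open>f x\<close> onto the positive real axis, where \<open>f\<close> coincides with \<open>g\<close>.\<close>
    define c where "c = cnj (f x) / of_real (norm (f x))"
    have nc: "norm c = 1"
      using False by (simp add: c_def norm_divide)
    have "f (s c x) = of_real (norm (f x))"
      using False by (simp add: f_scale c_def complex_norm_square power2_eq_square mult.commute[of "cnj (f x)"]
          flip: complex_norm_square)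
    then have "norm (f x) = g (s c x)"
      by (metis Re_complex_of_real complex.sel(1) f_def)
    also have "\<dots> \<le> norm x"
      using g(2)[of "s c x"] nc by (simp add: s_norm)
    finally show ?thesis .
  qed simp
  have "bounded_linear f"
  proof (rule bounded_linear_intro[of f 1])
    show "f (x + y) = f x + f y" for x y
      using g(1) by (simp add: f_def scale_right_distrib linear_add complex_eq_iff)
    show "f (r *\<^sub>R x) = r *\<^sub>R f x" for r x
      using f_scale[of "of_real r" x] by (simp add: s_real scaleR_conv_of_real)
  qed (use f_norm in auto)
  moreover have "onorm f \<le> 1"
    using f_norm by (intro onorm_bound) auto
  ultimately have "f \<in> dual_ball s"
    using f_scale by (simp add: dual_ball_def dual_def)
  then show "\<exists>f\<in>dual_ball s. \<forall>x. Re (f x) = g x"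
    by (intro bexI[of _ f]) (auto simp: f_def)
qed (auto simp: abs_Re_le_cmod)

theorem corollary5p4:
  fixes sR :: "real \<Rightarrow> 'a::banach \<Rightarrow> 'a"
    and sC :: "complex \<Rightarrow> 'b::banach \<Rightarrow> 'b"
  shows "(normed_scalar_mult sR \<and> quant_weakly_seq_complete sR \<and> schur_property sR \<longrightarrow>
            (equivalent_quantities (wk sR) (omega sR) \<longleftrightarrow> quant_schur_property sR)) \<and>
         (normed_scalar_mult sC \<and> quant_weakly_seq_complete sC \<and> schur_property sC \<longrightarrow>
            (equivalent_quantities (wk sC) (omega sC) \<longleftrightarrow> quant_schur_property sC))"
  using scalar_space.equivalent_iff_quant_schur[OF scalar_space_real]
    scalar_space.equivalent_iff_quant_schur[OF scalar_space_complex] by blast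

end
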